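(* Let $X$ be the Ornstein–Uhlenbeck process $dX_t=\mu(\theta-X_t)\,dt+\sigma\,dB_t$ with constants $\mu,\sigma>0$, $\theta\in\mathbb{R}$, driven by a standard Brownian motion $B$, let $r>0$ and $c_s>0$ be constants, and let $\mathcal{T}$ be the set of all stopping times with respect to the filtration generated by $B$. Define \[F(x)=\int_0^\infty u^{\frac{r}{\mu}-1}e^{\sqrt{\frac{2\mu}{\sigma^2}}(x-\theta)u-\frac{u^2}{2}}\,du .\] Consider the optimal stopping problem \[V(x)=\sup_{\tau\in\mathcal{T}}\mathbb{E}_x\{e^{-r\tau}(e^{X_\tau}-c_s)\},\qquad x\in\mathbb{R},\] where $\mathbb{E}_x$ denotes expectation given $X_0=x$. Then the equation $e^{b}F(b)=(e^{b}-c_s)F'(b)$ has a unique solution $b^*$, and \[V(x)=\begin{cases}\dfrac{e^{b^*}-c_s}{F(b^* )}F(x), & x<b^*,\\[2mm] e^x-c_s, & x\ge b^*.\end{cases}\] Moreover, the optimal liquidation time is $\tau^*=\inf\{t\ge0: X_t\ge b^*\}=\inf\{t\ge 0: e^{X_t}\ge e^{b^*}\}$.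
   Context: The price process is the exponential OU process $\xi_t=e^{X_t}$. $F$ is a positive, strictly increasing, convex solution of $\frac{\sigma^2}{2}u''+\mu(\theta-x)u'=ru$. *)

theory Defs
  imports "HOL-Probability.Probability"
begin

definition nat_filtration :: "'a measure \<Rightarrow> (real \<Rightarrow> 'a \<Rightarrow> real) \<Rightarrow> ennreal \<Rightarrow> 'a measure" where
  "nat_filtration M B t = sigma (space M)
     {{\<omega> \<in> space M. B u \<omega> \<in> A} | u A. 0 \<le> u \<and> ennreal u \<le> t \<and> A \<in> sets borel}"

definition std_brownian_motion :: "'a measure \<Rightarrow> (real \<Rightarrow> 'a \<Rightarrow> real) \<Rightarrow> bool" where
  "std_brownian_motion M B \<longleftrightarrow>
     prob_space M \<and>
     (\<forall>t\<ge>0. B t \<in> borel_measurable M) \<and>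
     (\<forall>\<omega>\<in>space M. B 0 \<omega> = 0 \<and> continuous_on {0..} (\<lambda>t. B t \<omega>)) \<and>
     (\<forall>s t. 0 \<le> s \<and> s < t \<longrightarrow>
        distributed M lborel (\<lambda>\<omega>. B t \<omega> - B s \<omega>) (normal_density 0 (sqrt (t - s)))) \<and>
     (\<forall>s t. 0 \<le> s \<and> s \<le> t \<longrightarrow>
        prob_space.indep_set M
          {{\<omega> \<in> space M. B t \<omega> - B s \<omega> \<in> A} | A. A \<in> sets borel}
          (sets (nat_filtration M B (ennreal s))))"

text \<open>The OU process started at x: X x is a pathwise (continuous) solution of
  X_t = x + int_0^t mu (theta - X_s) ds + sigma B_t, the integral form of
  dX_t = mu (theta - X_t) dt + sigma dB_t (additive noise, no stochastic integral needed).\<close>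
definition is_OU_process ::
  "'a measure \<Rightarrow> (real \<Rightarrow> 'a \<Rightarrow> real) \<Rightarrow> real \<Rightarrow> real \<Rightarrow> real \<Rightarrow> (real \<Rightarrow> real \<Rightarrow> 'a \<Rightarrow> real) \<Rightarrow> bool" where
  "is_OU_process M B \<mu> \<theta> \<sigma> X \<longleftrightarrow>
     (\<forall>x. \<forall>\<omega>\<in>space M. continuous_on {0..} (\<lambda>t. X x t \<omega>) \<and>
        (\<forall>t\<ge>0. X x t \<omega> = x + integral {0..t} (\<lambda>s. \<mu> * (\<theta> - X x s \<omega>)) + \<sigma> * B t \<omega>))"

definition liquidation_reward ::
  "real \<Rightarrow> real \<Rightarrow> (real \<Rightarrow> 'a \<Rightarrow> real) \<Rightarrow> ('a \<Rightarrow> ennreal) \<Rightarrow> 'a \<Rightarrow> real" where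
  "liquidation_reward r c Y \<tau> \<omega> =
     (if \<tau> \<omega> = \<infinity> then 0
      else exp (- r * enn2real (\<tau> \<omega>)) * (exp (Y (enn2real (\<tau> \<omega>)) \<omega>) - c))"

text \<open>Expectation as an extended real: E[f^+] - E[f^-] (well defined whenever E[f^-] < oo,
  which holds here since the reward is bounded below by -c_s).\<close>
definition ereal_expectation :: "'a measure \<Rightarrow> ('a \<Rightarrow> real) \<Rightarrow> ereal" where
  "ereal_expectation M f =
     enn2ereal (\<integral>\<^sup>+ \<omega>. ennreal (f \<omega>) \<partial>M) - enn2ereal (\<integral>\<^sup>+ \<omega>. ennreal (- f \<omega>) \<partial>M)"

definition OU_value ::
  "'a measure \<Rightarrow> (real \<Rightarrow> 'a \<Rightarrow> real) \<Rightarrow> (real \<Rightarrow> real \<Rightarrow> 'a \<Rightarrow> real) \<Rightarrow> real \<Rightarrow> real \<Rightarrow> real \<Rightarrow> ereal" where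
  "OU_value M B X r c x =
     (SUP \<tau>\<in>{\<tau>. stopping_time (nat_filtration M B) \<tau>}.
        ereal_expectation M (liquidation_reward r c (X x) \<tau>))"

definition F_OU :: "real \<Rightarrow> real \<Rightarrow> real \<Rightarrow> real \<Rightarrow> real \<Rightarrow> real" where
  "F_OU \<mu> \<theta> \<sigma> r x =
     (LBINT u:{0<..}. u powr (r / \<mu> - 1) * exp (sqrt (2 * \<mu> / \<sigma>\<^sup>2) * (x - \<theta>) * u - u\<^sup>2 / 2))"

end

theory Submission
  imports Defs "HOL-Real_Asymp.Real_Asymp"
begin

text \<open>No Ito calculus is needed. In the variable y = sqrt(2 mu / sigma^2) (x - theta) the function F
  is a mixture of exponentials f(y), and F and its reflection f(-y) solve the stationary
  equation. Along the process, exp(-r t) f(y) and exp(-r t) f(-y) are mixtures of the exponential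
  martingales of the Gaussian process exp(mu t) (X_t - theta), so optional stopping for these
  martingales gives the supermartingale inequality for every stopping time.
  The Wronskian of the gain and f has a single zero, the threshold, because the generator applied
  to the gain changes sign exactly once. Beyond the threshold
  the gain has a supporting line p f(y) + q f(-y) with p, q nonnegative that touches it at the
  starting point, and below it the line through the threshold with q = 0 works; this bounds the
  value from above. The bound is attained at the hitting time because F is bounded below the
  threshold.\<close>

section \<open>The fundamental solution\<close>

text \<open>The usual verification applies Ito's formula to the glued value function, whose second
  derivative jumps at the threshold. Here each starting point beyond the threshold gets its own
  majorant, an exact combination of two solutions, so only solutions ever have to be stopped.
  Mixtures work because the weight u^(\<rho>-1) du with \<rho> = r / \<mu> is homogeneous of degree
  \<rho>: rescaling u by exp(\<mu> t) produces exp(r t), which cancels the discount. The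
  normalisation \<alpha>^2 \<sigma>^2 = 2 \<mu> then splits the Gaussian factor into a fixed weight
  and exactly the variance correction of an exponential martingale. Two obstacles shape the rest.
  The Wiener integral behind the Gaussian process is available only as a pathwise limit of sums, so
  limits of expectations need uniform integrability; it comes from second moments, since squaring an
  exponential merely doubles its parameter. And for unbounded stopping times Fatou yields only an
  inequality, because F outgrows every exponential and mass may escape.\<close>

definition hermite_integrand :: "real \<Rightarrow> real \<Rightarrow> real \<Rightarrow> real" where
  "hermite_integrand \<rho> y u = u powr (\<rho> - 1) * exp (y * u - u\<^sup>2 / 2)"

definition hermite_fun :: "real \<Rightarrow> real \<Rightarrow> real" where
  "hermite_fun \<rho> y = (LBINT u:{0<..}. hermite_integrand \<rho> y u)"

lemma borel_measurable_hermite_integrand [measurable]: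
  "hermite_integrand \<rho> y \<in> borel_measurable borel"
  unfolding hermite_integrand_def[abs_def] by measurable

lemma set_integrable_Gamma:
  fixes s :: real
  assumes "s > 0"
  shows "set_integrable lborel {0<..} (\<lambda>u. u powr (s - 1) * exp (- u))"
proof -
  have "integrable lborel (\<lambda>t. indicator {0..} t * t powr (s - 1) / exp t)"
  proof (rule integrableI_nn_integral_finite)
    show "(\<integral>\<^sup>+ x. ennreal (indicator {0..} x * x powr (s - 1) / exp x) \<partial>lborel) = ennreal (Gamma s)"
      using Gamma_conv_nn_integral_real[OF assms] by simp
  qed auto
  then have "set_integrable lborel {0..} (\<lambda>u. u powr (s - 1) * exp (- u))"
    unfolding set_integrable_def
    by (rule Bochner_Integration.integrable_cong[THEN iffD1, rotated -1])
       (auto simp: indicator_def exp_minus field_simps)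
  then show ?thesis
    by (rule set_integrable_subset) auto
qed

text \<open>Completing the square around u = y + 1. Trading the Gaussian for exp(-u) lets the Gamma
  integral dominate, and later kills the boundary term at infinity in the recurrence.\<close>

lemma exp_gaussian_le: "exp (y * u - u\<^sup>2 / 2) \<le> exp ((y + 1)\<^sup>2 / 2) * exp (- u)" for u y :: real
proof -
  have "y * u - u\<^sup>2 / 2 \<le> (y + 1)\<^sup>2 / 2 + (- u)"
    using zero_le_power2[of "u - (y + 1)"] by (simp add: power2_eq_square field_simps)
  then show ?thesis
    by (simp add: exp_add[symmetric])
qed

lemma set_integrable_hermite:
  assumes "\<rho> > 0"
  shows "set_integrable lborel {0<..} (hermite_integrand \<rho> y)"
proof -
  have "set_integrable lborel {0<..} (\<lambda>u. exp ((y + 1)\<^sup>2 / 2) * (u powr (\<rho> - 1) * exp (- u)))"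
    using set_integrable_Gamma[OF assms] by (rule set_integrable_mult_right)
  then show ?thesis
  proof (rule set_integrable_bound)
    show "set_borel_measurable lborel {0<..} (hermite_integrand \<rho> y)"
      unfolding set_borel_measurable_def by measurable
    have "u powr (\<rho> - 1) * exp (y * u - u\<^sup>2 / 2)
      \<le> u powr (\<rho> - 1) * (exp ((y + 1)\<^sup>2 / 2) * exp (- u))" for u
      by (intro mult_left_mono exp_gaussian_le) auto
    then show "AE u in lborel. u \<in> {0<..} \<longrightarrow>
      norm (hermite_integrand \<rho> y u) \<le> norm (exp ((y + 1)\<^sup>2 / 2) * (u powr (\<rho> - 1) * exp (- u)))"
      by (intro AE_I2) (auto simp: hermite_integrand_def mult_ac)
  qed
qed

text \<open>The cut-off N serves two ends: N = 0 gives positivity of the whole integral, larger N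
  gives the constant in the growth bound.\<close>

lemma hermite_tail_pos:
  assumes "\<rho> > 0" "N \<ge> 0"
  shows "(LBINT u:{N<..}. hermite_integrand \<rho> y u) > 0"
proof -
  have int: "set_integrable lborel {N<..} (hermite_integrand \<rho> y)"
    by (rule set_integrable_subset[OF set_integrable_hermite[OF assms(1)]]) (use assms in auto)
  have nonneg: "AE u in lborel. 0 \<le> indicator {N<..} u *\<^sub>R hermite_integrand \<rho> y u"
    by (auto simp: hermite_integrand_def)
  have "(LBINT u:{N<..}. hermite_integrand \<rho> y u) \<noteq> 0"
  proof
    assume "(LBINT u:{N<..}. hermite_integrand \<rho> y u) = 0"
    then have "AE u in lborel. indicator {N<..} u *\<^sub>R hermite_integrand \<rho> y u = 0"
      using integral_nonneg_eq_0_iff_AE[OF int[unfolded set_integrable_def] nonneg]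
      by (simp add: set_lebesgue_integral_def)
    then have "AE u in lborel. u \<notin> {N<..}"
      by eventually_elim (use assms(2) in \<open>auto simp: hermite_integrand_def indicator_def\<close>)
    then have "emeasure lborel {N<..} = 0"
      by (subst (asm) AE_iff_measurable[of "{N<..}"]) auto
    then have "emeasure lborel {N+1..N+2} = 0"
      by (rule emeasure_eq_0[rotated]) auto
    then show False by simp
  qed
  moreover have "(LBINT u:{N<..}. hermite_integrand \<rho> y u) \<ge> 0"
    using nonneg unfolding set_lebesgue_integral_def by (rule integral_nonneg_AE)
  ultimately show ?thesis by simp
qed

lemma hermite_fun_pos:
  assumes "\<rho> > 0"
  shows "hermite_fun \<rho> y > 0"
  using hermite_tail_pos[OF assms, of 0] by (simp add: hermite_fun_def)

text \<open>For u > N and y \<ge> 0 the factor exp(y u) is at least exp(N y), and the tail integral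
  at y = 0 is the constant. As N is arbitrary, the function outgrows every exponential, in
  particular the gain.\<close>

lemma hermite_fun_exp_growth:
  assumes "\<rho> > 0" "N \<ge> 0"
  obtains C where "C > 0" "\<And>y. y \<ge> 0 \<Longrightarrow> hermite_fun \<rho> y \<ge> C * exp (N * y)"
proof
  show "(LBINT u:{N<..}. hermite_integrand \<rho> 0 u) > 0"
    using assms by (rule hermite_tail_pos)
  fix y :: real assume y: "y \<ge> 0"
  have int: "set_integrable lborel {N<..} (hermite_integrand \<rho> z)" for z
    by (rule set_integrable_subset[OF set_integrable_hermite[OF assms(1)]]) (use assms in auto)
  have "(LBINT u:{N<..}. hermite_integrand \<rho> 0 u) * exp (N * y)
    = (LBINT u:{N<..}. hermite_integrand \<rho> 0 u * exp (N * y))"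
    by simp
  also have "\<dots> \<le> (LBINT u:{N<..}. hermite_integrand \<rho> y u)"
  proof (rule set_integral_mono[OF _ int])
    show "set_integrable lborel {N<..} (\<lambda>u. hermite_integrand \<rho> 0 u * exp (N * y))"
      using int by simp
    fix u assume "u \<in> {N<..}"
    then have "exp (N * y) \<le> exp (y * u)"
      using y by (simp add: mult.commute[of y] mult_right_mono)
    then have "u powr (\<rho> - 1) * exp (- (u\<^sup>2 / 2)) * exp (N * y)
      \<le> u powr (\<rho> - 1) * exp (- (u\<^sup>2 / 2)) * exp (y * u)"
      by (intro mult_left_mono) auto
    moreover have "hermite_integrand \<rho> z u = u powr (\<rho> - 1) * exp (- (u\<^sup>2 / 2)) * exp (z * u)" for z
      by (simp add: hermite_integrand_def exp_add[symmetric] mult.assoc)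
    ultimately show "hermite_integrand \<rho> 0 u * exp (N * y) \<le> hermite_integrand \<rho> y u"
      by simp
  qed
  also have "\<dots> \<le> hermite_fun \<rho> y"
    unfolding hermite_fun_def set_lebesgue_integral_def
    using int[of y] set_integrable_hermite[OF assms(1), of y] assms(2)
    by (intro integral_mono) (auto simp: set_integrable_def indicator_def hermite_integrand_def)
  finally show "hermite_fun \<rho> y \<ge> (LBINT u:{N<..}. hermite_integrand \<rho> 0 u) * exp (N * y)" .
qed

section \<open>Differentiation under the integral and the stationary equation\<close>

text \<open>Lagrange remainder of second order. The crude factor exp |x| is harmless: for x = h u
  with |h| \<le> 1 it becomes at most exp u, which is a unit shift of y.\<close>

lemma abs_exp_minus_linear_le: "\<bar>exp x - 1 - x\<bar> \<le> x\<^sup>2 * exp \<bar>x\<bar>" for x :: real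
proof -
  obtain t where t: "\<bar>t\<bar> \<le> \<bar>x\<bar>" "exp x = (\<Sum>m<2. x ^ m / fact m) + exp t / fact 2 * x ^ 2"
    using Maclaurin_exp_le[of x 2] by blast
  have "exp x - 1 - x = exp t / 2 * x\<^sup>2"
    using t(2) by (simp add: numeral_2_eq_2)
  moreover have "exp t / 2 \<le> exp \<bar>x\<bar>"
    using t(1) by (smt (verit) exp_le_cancel_iff exp_gt_zero field_sum_of_halves)
  ultimately show ?thesis
    using mult_right_mono[of "exp t / 2" "exp \<bar>x\<bar>" "x\<^sup>2"]
    by (simp only: abs_mult abs_power2 abs_of_pos exp_gt_zero half_gt_zero_iff
        zero_le_power2 mult.commute[of "x\<^sup>2"])
qed

lemma hermite_integrand_plus:
  assumes "u > 0"
  shows "hermite_integrand (\<rho> + 1) y u = u * hermite_integrand \<rho> y u"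
  using assms by (simp add: hermite_integrand_def powr_diff)

lemma hermite_integrand_plus2:
  assumes "u > 0"
  shows "hermite_integrand (\<rho> + 2) y u = u\<^sup>2 * hermite_integrand \<rho> y u"
  using hermite_integrand_plus[OF assms, of \<rho> y] hermite_integrand_plus[OF assms, of "\<rho> + 1" y]
  by (simp add: power2_eq_square add.assoc)

text \<open>The Taylor remainder is integrated pointwise: the factor u^2 raises the parameter by 2
  and exp u shifts y by 1, so the error is again a value of the same family. This replaces dominated
  convergence in the differentiation.\<close>

lemma hermite_fun_quadratic_estimate:
  assumes "\<rho> > 0" "\<bar>h\<bar> \<le> 1"
  shows "\<bar>hermite_fun \<rho> (y + h) - hermite_fun \<rho> y - h * hermite_fun (\<rho> + 1) y\<bar>
    \<le> h\<^sup>2 * hermite_fun (\<rho> + 2) (y + 1)"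
proof -
  have i: "set_integrable lborel {0<..} (hermite_integrand \<rho> (y + h))"
    "set_integrable lborel {0<..} (hermite_integrand \<rho> y)"
    "set_integrable lborel {0<..} (\<lambda>u. h * hermite_integrand (\<rho> + 1) y u)"
    "set_integrable lborel {0<..} (\<lambda>u. h\<^sup>2 * hermite_integrand (\<rho> + 2) (y + 1) u)"
    using assms by (auto intro!: set_integrable_hermite set_integrable_mult_right)
  note i2 = set_integral_diff(1)[OF set_integral_diff(1)[OF i(1,2)] i(3)]
  have eq: "hermite_fun \<rho> (y + h) - hermite_fun \<rho> y - h * hermite_fun (\<rho> + 1) y
    = (LBINT u:{0<..}. hermite_integrand \<rho> (y + h) u - hermite_integrand \<rho> y u
          - h * hermite_integrand (\<rho> + 1) y u)"
    unfolding hermite_fun_def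
    by (simp add: set_integral_diff[OF set_integral_diff(1)[OF i(1,2)] i(3)] set_integral_diff[OF i(1,2)])
  have "\<bar>hermite_fun \<rho> (y + h) - hermite_fun \<rho> y - h * hermite_fun (\<rho> + 1) y\<bar> \<le> (LBINT u:{0<..}. \<bar>hermite_integrand \<rho> (y + h) u - hermite_integrand \<rho> y u
          - h * hermite_integrand (\<rho> + 1) y u\<bar>)"
    unfolding eq using set_integral_norm_bound[OF i2] by (simp only: real_norm_def)
  also have "\<dots> \<le> (LBINT u:{0<..}. h\<^sup>2 * hermite_integrand (\<rho> + 2) (y + 1) u)"
  proof (rule set_integral_mono)
    show "set_integrable lborel {0<..} (\<lambda>u. \<bar>hermite_integrand \<rho> (y + h) u - hermite_integrand \<rho> y u
          - h * hermite_integrand (\<rho> + 1) y u\<bar>)"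
      using i2 by (rule set_integrable_abs)
    show "set_integrable lborel {0<..} (\<lambda>u. h\<^sup>2 * hermite_integrand (\<rho> + 2) (y + 1) u)"
      by (rule i(4))
    fix u :: real assume "u \<in> {0<..}"
    then have u: "u > 0" by simp
    define H where "H = hermite_integrand \<rho> y u"
    have H0: "H \<ge> 0"
      by (simp add: H_def hermite_integrand_def)
    have shift: "hermite_integrand \<rho> (y + k) u = H * exp (k * u)" for k
    proof -
      have "(y + k) * u - u\<^sup>2 / 2 = (y * u - u\<^sup>2 / 2) + k * u"
        by (simp add: algebra_simps)
      then show ?thesis
        unfolding H_def hermite_integrand_def by (metis exp_add mult.assoc)
    qed
    have eq: "hermite_integrand \<rho> (y + h) u - hermite_integrand \<rho> y u - h * hermite_integrand (\<rho> + 1) y u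
      = H * (exp (h * u) - 1 - h * u)"
      unfolding shift hermite_integrand_plus[OF u] H_def[symmetric] by (simp add: algebra_simps)
    have "\<bar>hermite_integrand \<rho> (y + h) u - hermite_integrand \<rho> y u - h * hermite_integrand (\<rho> + 1) y u\<bar>
      \<le> H * ((h * u)\<^sup>2 * exp \<bar>h * u\<bar>)"
      unfolding eq abs_mult[of H] abs_of_nonneg[OF H0]
      by (intro mult_left_mono abs_exp_minus_linear_le H0)
    also have "\<dots> \<le> H * ((h * u)\<^sup>2 * exp u)"
    proof -
      have "\<bar>h * u\<bar> \<le> u"
        using assms(2) u by (simp add: abs_mult mult_left_le_one_le)
      then show ?thesis
        by (intro mult_left_mono H0) auto
    qed
    also have "\<dots> = h\<^sup>2 * hermite_integrand (\<rho> + 2) (y + 1) u"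
      unfolding hermite_integrand_plus2[OF u] shift
      by (simp add: power_mult_distrib power2_eq_square ac_simps)
    finally show "\<bar>hermite_integrand \<rho> (y + h) u - hermite_integrand \<rho> y u
          - h * hermite_integrand (\<rho> + 1) y u\<bar> \<le> h\<^sup>2 * hermite_integrand (\<rho> + 2) (y + 1) u" .
  qed
  finally show ?thesis
    by (simp add: hermite_fun_def)
qed

lemma hermite_fun_has_field_derivative:
  assumes "\<rho> > 0"
  shows "(hermite_fun \<rho> has_field_derivative hermite_fun (\<rho> + 1) y) (at y)"
  unfolding DERIV_def
proof (rule LIM_zero_cancel, rule Lim_null_comparison)
  let ?K = "hermite_fun (\<rho> + 2) (y + 1)"
  show "((\<lambda>h. \<bar>h\<bar> * ?K) \<longlongrightarrow> 0) (at 0)"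
    by (auto intro!: tendsto_eq_intros)
  have "\<forall>\<^sub>F h in at (0::real). \<bar>h\<bar> < 1 \<and> h \<noteq> 0"
    by (auto simp: eventually_at intro!: exI[of _ 1])
  then show "\<forall>\<^sub>F h in at 0. norm ((hermite_fun \<rho> (y + h) - hermite_fun \<rho> y) / h
      - hermite_fun (\<rho> + 1) y) \<le> \<bar>h\<bar> * ?K"
  proof eventually_elim
    case (elim h)
    have "\<bar>(hermite_fun \<rho> (y + h) - hermite_fun \<rho> y) / h - hermite_fun (\<rho> + 1) y\<bar> * \<bar>h\<bar>
      = \<bar>hermite_fun \<rho> (y + h) - hermite_fun \<rho> y - h * hermite_fun (\<rho> + 1) y\<bar>"
      using elim by (simp add: abs_mult[symmetric] field_simps)
    also have "\<dots> \<le> \<bar>h\<bar> * ?K * \<bar>h\<bar>"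
      using hermite_fun_quadratic_estimate[OF assms, of h y] elim
      by (metis abs_mult_self_eq less_imp_le mult.assoc mult.commute power2_eq_square)
    finally show ?case
      using elim by (simp add: mult.commute[of "\<bar>h\<bar>"])
  qed
qed

text \<open>Integrate the derivative of u^\<rho> exp(y u - u^2/2) over the half line; both boundary
  terms vanish, the one at 0 because \<rho> > 0. As differentiation raises the parameter by 1, this
  is the equation f'' - y f' = \<rho> f, the stationary equation in the scaled variable.\<close>

lemma hermite_fun_recurrence:
  assumes "\<rho> > 0"
  shows "hermite_fun (\<rho> + 2) y - y * hermite_fun (\<rho> + 1) y = \<rho> * hermite_fun \<rho> y"
proof -
  define f where "f = (\<lambda>u::real. u powr \<rho> * exp (y * u - u\<^sup>2 / 2))"
  define f' where "f' = (\<lambda>u. \<rho> * hermite_integrand \<rho> y u + y * hermite_integrand (\<rho> + 1) y u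
      - hermite_integrand (\<rho> + 2) y u)"
  have i: "set_integrable lborel {0<..} (\<lambda>u. \<rho> * hermite_integrand \<rho> y u)"
    "set_integrable lborel {0<..} (\<lambda>u. y * hermite_integrand (\<rho> + 1) y u)"
    "set_integrable lborel {0<..} (hermite_integrand (\<rho> + 2) y)"
    using assms by (auto intro!: set_integrable_hermite set_integrable_mult_right)
  have "(LBINT u=0..\<infinity>. f' u) = 0 - 0"
  proof (rule interval_integral_FTC_integrable)
    fix u :: real assume "0 < ereal u" "ereal u < \<infinity>"
    then have u: "u > 0" by simp
    have "(f has_field_derivative (\<rho> * u powr (\<rho> - 1) * exp (y * u - u\<^sup>2 / 2) + u powr \<rho> * (exp (y * u - u\<^sup>2 / 2) * (y - u)))) (at u)"
      unfolding f_def using u by (auto intro!: derivative_eq_intros simp: field_simps powr_diff)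
    also have "\<rho> * u powr (\<rho> - 1) * exp (y * u - u\<^sup>2 / 2) + u powr \<rho> * (exp (y * u - u\<^sup>2 / 2) * (y - u)) = f' u"
      using u by (simp add: f'_def hermite_integrand_def algebra_simps powr_add)
    finally show "(f has_vector_derivative f' u) (at u)"
      by (simp add: has_real_derivative_iff_has_vector_derivative)
    show "isCont f' u"
      using u unfolding f'_def hermite_integrand_def by (intro continuous_intros) auto
  next
    have "einterval 0 \<infinity> = {0<..}"
      by (auto simp: einterval_def)
    then show "set_integrable lborel (einterval 0 \<infinity>) f'"
      unfolding f'_def
      using set_integral_diff(1)[OF set_integral_add(1)[OF i(1,2)] i(3)] by simp
    have "(f \<longlongrightarrow> 0) (at_right 0)"
      unfolding f_def using assms by real_asymp
    then show "((f \<circ> real_of_ereal) \<longlongrightarrow> 0) (at_right 0)"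
      using ereal_tendsto_simps1(2)[of f 0 0] by (simp add: zero_ereal_def)
    have "(f \<longlongrightarrow> 0) at_top"
    proof (rule tendsto_sandwich[OF _ _ tendsto_const])
      show "((\<lambda>u. exp ((y + 1)\<^sup>2 / 2) * (u powr \<rho> * exp (- u))) \<longlongrightarrow> 0) at_top"
        by (rule tendsto_mult_right_zero) real_asymp
      show "\<forall>\<^sub>F u in at_top. f u \<le> exp ((y + 1)\<^sup>2 / 2) * (u powr \<rho> * exp (- u))"
        unfolding f_def mult.left_commute[of "exp ((y + 1)\<^sup>2 / 2)"]
        by (intro always_eventually allI mult_left_mono exp_gaussian_le) auto
    qed (simp add: f_def)
    then show "((f \<circ> real_of_ereal) \<longlongrightarrow> 0) (at_left \<infinity>)"
      using ereal_tendsto_simps1(3)[of f 0] by simp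
  qed simp
  then have "(LBINT u:{0<..}. f' u) = 0"
    by (simp add: interval_lebesgue_integral_0_infty)
  then show ?thesis
    unfolding f'_def hermite_fun_def
    by (simp add: set_integral_diff[OF set_integral_add(1)[OF i(1,2)] i(3)] set_integral_add[OF i(1,2)])
qed

section \<open>The stopping threshold\<close>

locale liquidation_threshold =
  fixes \<rho> \<kappa> \<theta> c :: real
  assumes rho_pos: "\<rho> > 0" and kappa_pos: "\<kappa> > 0" and cost_pos: "c > 0"
begin

text \<open>The payoff in the scaled variable: \<kappa> will be 1/\<alpha>, so \<theta> + \<kappa> y
  is the original coordinate x.\<close>

definition gain :: "real \<Rightarrow> real" where
  "gain y = exp (\<theta> + \<kappa> * y) - c"

text \<open>This is g' f - g f' for the gain g, times the integrating factor exp(-y^2/2) of f'' - y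
  f'. Its zeros are the points of smooth fit, and up to a positive factor it is the derivative of g
  / f.\<close>

definition gain_wronskian :: "real \<Rightarrow> real" where
  "gain_wronskian y = exp (- (y\<^sup>2 / 2)) *
     (\<kappa> * exp (\<theta> + \<kappa> * y) * hermite_fun \<rho> y - gain y * hermite_fun (\<rho> + 1) y)"

text \<open>The generator expression g'' - y g' - \<rho> g of the gain g, divided by the positive
  factor exp(\<theta> + \<kappa> y).\<close>

definition drift_sign :: "real \<Rightarrow> real" where
  "drift_sign y = \<kappa>\<^sup>2 - \<kappa> * y - \<rho> + \<rho> * c * exp (- (\<theta> + \<kappa> * y))"

abbreviation (input) "f0 \<equiv> hermite_fun \<rho>"
abbreviation (input) "f1 \<equiv> hermite_fun (\<rho> + 1)"
abbreviation (input) "f2 \<equiv> hermite_fun (\<rho> + 2)"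

lemma f_pos: "f0 y > 0" "f1 y > 0"
  using rho_pos by (auto intro: hermite_fun_pos)

lemma f_deriv:
  "(u has_field_derivative u') (at x within S) \<Longrightarrow>
    ((\<lambda>x. f0 (u x)) has_field_derivative f1 (u x) * u') (at x within S)"
  "(u has_field_derivative u') (at x within S) \<Longrightarrow>
    ((\<lambda>x. f1 (u x)) has_field_derivative f2 (u x) * u') (at x within S)"
proof -
  show "(u has_field_derivative u') (at x within S) \<Longrightarrow>
    ((\<lambda>x. f0 (u x)) has_field_derivative f1 (u x) * u') (at x within S)"
    by (rule DERIV_chain2[where f = f0], rule hermite_fun_has_field_derivative[OF rho_pos])
  show "(u has_field_derivative u') (at x within S) \<Longrightarrow>
    ((\<lambda>x. f1 (u x)) has_field_derivative f2 (u x) * u') (at x within S)"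
    using hermite_fun_has_field_derivative[of "\<rho> + 1" "u x"] rho_pos
    by (intro DERIV_chain2[where f = f1]) (auto simp: add.assoc)
qed

lemma f2_eq: "f2 y = y * f1 y + \<rho> * f0 y"
  using hermite_fun_recurrence[OF rho_pos, of y] by simp

lemma gain_has_derivative:
  "(gain has_field_derivative \<kappa> * exp (\<theta> + \<kappa> * y)) (at y)"
  unfolding gain_def by (auto intro!: derivative_eq_intros)

lemma gain_mono: "y \<le> z \<Longrightarrow> gain y \<le> gain z"
  using kappa_pos by (simp add: gain_def)

text \<open>The integrating factor absorbs the first-order terms and \<open>f2_eq\<close> eliminates
  f'', so only f times the generator of the gain is left.\<close>

lemma gain_wronskian_has_derivative:
  "(gain_wronskian has_field_derivative exp (- (y\<^sup>2 / 2)) * f0 y * exp (\<theta> + \<kappa> * y) * drift_sign y) (at y)"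
proof -
  let ?E = "exp (\<theta> + \<kappa> * y)" and ?m = "exp (- (y\<^sup>2 / 2))"
  have "(gain_wronskian has_field_derivative
     (?m * (- y)) * (\<kappa> * ?E * f0 y - gain y * f1 y) +
     ?m * ((\<kappa> * (?E * \<kappa>)) * f0 y + \<kappa> * ?E * f1 y - (\<kappa> * ?E * f1 y + gain y * f2 y))) (at y)"
    unfolding gain_wronskian_def
    by (auto intro!: derivative_eq_intros f_deriv gain_has_derivative)
  moreover have "?E * exp (- (\<theta> + \<kappa> * y)) = 1"
    by (simp only: exp_minus_inverse)
  then have "?E * drift_sign y = ?E * (\<kappa>\<^sup>2 - \<kappa> * y - \<rho>) + \<rho> * c"
    unfolding drift_sign_def by algebra
  then have "(?m * (- y)) * (\<kappa> * ?E * f0 y - gain y * f1 y) +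
     ?m * ((\<kappa> * (?E * \<kappa>)) * f0 y + \<kappa> * ?E * f1 y - (\<kappa> * ?E * f1 y + gain y * f2 y))
     = ?m * f0 y * ?E * drift_sign y"
    unfolding f2_eq gain_def by algebra
  ultimately show ?thesis
    by simp
qed

lemma drift_sign_strict_antimono: "x < y \<Longrightarrow> drift_sign y < drift_sign x"
  unfolding drift_sign_def using kappa_pos rho_pos cost_pos
  by (smt (verit) exp_le_cancel_iff mult_le_cancel_left_pos mult_less_cancel_left_pos mult_pos_pos)

lemma drift_sign_zero: "\<exists>y. drift_sign y = 0"
proof -
  \<comment> \<open>At \<open>y1\<close> the affine part vanishes and the positive cost term
    remains. At \<open>y2\<close>, which is nonnegative, the cost term is at most its value at 0,
    and \<kappa> \<open>y2\<close> outweighs that value together with \<kappa>^2.\<close>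
  define y1 where "y1 = (\<kappa>\<^sup>2 - \<rho>) / \<kappa>"
  define y2 where "y2 = max 0 ((\<kappa>\<^sup>2 + \<rho> * c * exp (- \<theta>)) / \<kappa>)"
  have "drift_sign y1 = \<rho> * c * exp (- (\<theta> + \<kappa> * y1))"
    using kappa_pos by (simp add: drift_sign_def y1_def)
  then have 1: "drift_sign y1 \<ge> 0"
    using rho_pos cost_pos by simp
  have "y2 \<ge> (\<kappa>\<^sup>2 + \<rho> * c * exp (- \<theta>)) / \<kappa>"
    by (simp add: y2_def)
  then have "\<kappa> * y2 \<ge> \<kappa>\<^sup>2 + \<rho> * c * exp (- \<theta>)"
    using kappa_pos by (simp only: pos_divide_le_eq mult.commute[of \<kappa>])
  moreover have "\<rho> * c * exp (- (\<theta> + \<kappa> * y2)) \<le> \<rho> * c * exp (- \<theta>)"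
  proof -
    have "\<kappa> * y2 \<ge> 0"
      using kappa_pos by (simp add: y2_def)
    then show ?thesis
      using rho_pos cost_pos by (intro mult_left_mono) auto
  qed
  ultimately have 2: "drift_sign y2 \<le> 0"
    using rho_pos unfolding drift_sign_def by linarith
  have "y1 \<le> y2"
    using 1 2 drift_sign_strict_antimono[of y2 y1] by (cases y1 y2 rule: linorder_cases) auto
  moreover have "isCont drift_sign x" for x
    unfolding drift_sign_def by (intro continuous_intros)
  ultimately show ?thesis
    using IVT2[of drift_sign y2 0 y1] 1 2 by blast
qed

text \<open>If the Wronskian stayed positive, the quotient of the gain by f would be nondecreasing,
  so f would grow at most like exp(\<kappa> y). This contradicts its growth of at least exp(2
  \<kappa> y).\<close>

lemma gain_wronskian_eventually_nonpos: "\<exists>y\<ge>x. gain_wronskian y \<le> 0"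
proof (rule ccontr)
  assume "\<not> ?thesis"
  then have pos: "gain_wronskian y > 0" if "y \<ge> x" for y
    using that by force
  \<comment> \<open>The three entries are for the growth bound (y \<ge> 0), for the assumed sign (y
    \<ge> x), and for a positive gain.\<close>
  define y1 where "y1 = Max {0, x, (ln c + 1 - \<theta>) / \<kappa>}"
  have y1: "y1 \<ge> 0" "y1 \<ge> x" "y1 \<ge> (ln c + 1 - \<theta>) / \<kappa>"
    by (auto simp: y1_def)
  have "ln c < \<theta> + \<kappa> * y1"
    using y1(3) kappa_pos by (simp add: field_simps)
  then have g1: "gain y1 > 0"
    using cost_pos exp_less_cancel_iff[of "ln c" "\<theta> + \<kappa> * y1"] by (simp add: gain_def)
  obtain C where C: "C > 0" "\<And>y. y \<ge> 0 \<Longrightarrow> f0 y \<ge> C * exp (2 * \<kappa> * y)"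
    using hermite_fun_exp_growth[OF rho_pos, of "2 * \<kappa>"] kappa_pos by auto
  define K where "K = gain y1 / f0 y1 * C"
  have K: "K > 0"
    using g1 C f_pos by (simp add: K_def)
  have up: "K * exp (\<kappa> * y) \<le> exp \<theta>" if "y \<ge> y1" for y
  proof -
    have "gain y1 / f0 y1 \<le> gain y / f0 y"
    proof (rule DERIV_nonneg_imp_nondecreasing[OF that])
      fix t assume t: "y1 \<le> t" "t \<le> y"
      have "((\<lambda>y. gain y / f0 y) has_field_derivative
        (\<kappa> * exp (\<theta> + \<kappa> * t) * f0 t - gain t * f1 t) / (f0 t * f0 t)) (at t)"
        using f_pos(1)[of t]
        by (auto intro!: derivative_eq_intros f_deriv gain_has_derivative)
      moreover have "(\<kappa> * exp (\<theta> + \<kappa> * t) * f0 t - gain t * f1 t) / (f0 t * f0 t) \<ge> 0"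
        using pos[of t] t y1(2) by (simp add: gain_wronskian_def zero_less_mult_iff)
      ultimately show "\<exists>d. ((\<lambda>y. gain y / f0 y) has_field_derivative d) (at t) \<and> 0 \<le> d"
        by blast
    qed
    then have "gain y1 / f0 y1 * f0 y \<le> gain y"
      using f_pos(1)[of y] by (simp add: pos_le_divide_eq)
    moreover have "gain y1 / f0 y1 * f0 y \<ge> gain y1 / f0 y1 * (C * exp (2 * \<kappa> * y))"
      using C(2)[of y] that y1 g1 f_pos(1)[of y1] by (intro mult_left_mono divide_nonneg_pos) auto
    moreover have "gain y \<le> exp \<theta> * exp (\<kappa> * y)"
      using cost_pos by (simp add: gain_def exp_add)
    moreover have "exp (2 * \<kappa> * y) = exp (\<kappa> * y) * exp (\<kappa> * y)"
      by (simp add: exp_add[symmetric])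
    ultimately have "(K * exp (\<kappa> * y)) * exp (\<kappa> * y) \<le> exp \<theta> * exp (\<kappa> * y)"
      by (simp add: K_def mult.assoc)
    then show ?thesis
      by simp
  qed
  \<comment> \<open>Chosen so that K exp(\<kappa> y) is at least exp(\<theta> + 1), beyond the bound
    exp \<theta> just derived.\<close>
  define y where "y = max y1 ((\<theta> + 1 - ln K) / \<kappa>)"
  have "\<kappa> * y \<ge> \<theta> + 1 - ln K"
    using kappa_pos by (simp add: y_def max_def field_simps)
  then have "exp (\<kappa> * y) \<ge> exp (\<theta> + 1 - ln K)"
    by simp
  also have "exp (\<theta> + 1 - ln K) = exp (\<theta> + 1) / K"
    using K by (simp add: exp_diff)
  finally have "K * exp (\<kappa> * y) \<ge> exp (\<theta> + 1)"
    using K by (simp add: field_simps)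
  then show False
    using up[of y] by (simp add: y_def) (smt (verit) exp_less_cancel_iff)
qed

text \<open>The Wronskian is nondecreasing up to the zero s of the generator and strictly decreasing
  afterwards. It is positive far to the left, hence up to s, so it can vanish only on the decreasing
  branch, and there only once.\<close>

lemma threshold_exists:
  obtains b where "gain_wronskian b = 0" "\<And>y. y < b \<Longrightarrow> gain_wronskian y > 0"
    "\<And>y z. b \<le> y \<Longrightarrow> y < z \<Longrightarrow> gain_wronskian z < gain_wronskian y"
proof -
  obtain s where s: "drift_sign s = 0"
    using drift_sign_zero by blast
  have decr: "gain_wronskian z < gain_wronskian y" if "s \<le> y" "y < z" for y z
  proof (rule DERIV_neg_imp_decreasing_open[OF that(2)])
    show "\<exists>d. (gain_wronskian has_field_derivative d) (at x) \<and> d < 0" if "y < x" "x < z" for x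
    proof (intro exI conjI, rule gain_wronskian_has_derivative)
      have "drift_sign x < 0"
        using drift_sign_strict_antimono[of s x] s that \<open>s \<le> y\<close> by simp
      then show "exp (- (x\<^sup>2 / 2)) * f0 x * exp (\<theta> + \<kappa> * x) * drift_sign x < 0"
        using f_pos(1)[of x] by (simp add: mult_pos_neg)
    qed
    show "continuous_on {y..z} gain_wronskian"
      by (meson DERIV_continuous_on DERIV_subset gain_wronskian_has_derivative top_greatest)
  qed
  have incr: "gain_wronskian y \<le> gain_wronskian z" if "z \<le> s" "y \<le> z" for y z
  proof (rule DERIV_nonneg_imp_nondecreasing[OF that(2)])
    fix x assume x: "y \<le> x" "x \<le> z"
    show "\<exists>d. (gain_wronskian has_field_derivative d) (at x) \<and> 0 \<le> d"
    proof (intro exI conjI, rule gain_wronskian_has_derivative)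
      have "drift_sign x \<ge> 0"
        using drift_sign_strict_antimono[of x s] s x that by (cases "x = s") auto
      then show "0 \<le> exp (- (x\<^sup>2 / 2)) * f0 x * exp (\<theta> + \<kappa> * x) * drift_sign x"
        using f_pos(1)[of x] by simp
    qed
  qed
  have pos: "gain_wronskian y > 0" if "y \<le> s" for y
  proof -
    \<comment> \<open>Far enough left for the gain to be nonpositive: both terms of the Wronskian
      then have the favourable sign, and monotonicity carries positivity over to y.\<close>
    define y0 where "y0 = min y ((ln c - \<theta>) / \<kappa>)"
    have "\<theta> + \<kappa> * y0 \<le> ln c"
      using kappa_pos by (simp add: y0_def min_def field_simps)
    then have "exp (\<theta> + \<kappa> * y0) \<le> exp (ln c)"
      by (simp only: exp_le_cancel_iff)
    then have "gain y0 \<le> 0"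
      using cost_pos by (simp add: gain_def)
    then have "gain y0 * f1 y0 \<le> 0"
      using f_pos(2)[of y0] by (simp add: mult_nonpos_nonneg)
    moreover have "\<kappa> * exp (\<theta> + \<kappa> * y0) * f0 y0 > 0"
      using kappa_pos f_pos(1)[of y0] by simp
    ultimately have "gain_wronskian y0 > 0"
      by (simp add: gain_wronskian_def)
    also have "gain_wronskian y0 \<le> gain_wronskian y"
      using that by (intro incr) (auto simp: y0_def)
    finally show ?thesis .
  qed
  obtain t where t: "t \<ge> s" "gain_wronskian t \<le> 0"
    using gain_wronskian_eventually_nonpos by blast
  obtain b where b: "s \<le> b" "gain_wronskian b = 0"
    using IVT2[of gain_wronskian t 0 s] t pos[of s] by (auto intro!: DERIV_isCont gain_wronskian_has_derivative)
  show ?thesis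
  proof (rule that[OF b(2)])
    show "gain_wronskian y > 0" if "y < b" for y
      using pos[of y] decr[of y b] b that by (cases "y \<le> s") auto
    show "gain_wronskian z < gain_wronskian y" if "b \<le> y" "y < z" for y z
      using decr[of y z] b that by simp
  qed
qed

section \<open>The reflected solution and supporting lines of the gain\<close>

text \<open>Abel's identity: f(y) and f(-y) solve the same equation, so their Wronskian times the
  integrating factor is constant. The plus sign stems from the derivative of f(-y); at 0 all terms
  are positive.\<close>

lemma wronskian_const:
  obtains w where "w > 0"
    "\<And>y. exp (- (y\<^sup>2 / 2)) * (f1 y * f0 (- y) + f0 y * f1 (- y)) = w"
proof -
  define W where "W = (\<lambda>y. exp (- (y\<^sup>2 / 2)) * (f1 y * f0 (- y) + f0 y * f1 (- y)))"
  have "(W has_field_derivative 0) (at y)" for y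
  proof -
    have "(W has_field_derivative
      (exp (- (y\<^sup>2 / 2)) * (- y)) * (f1 y * f0 (- y) + f0 y * f1 (- y)) +
      exp (- (y\<^sup>2 / 2)) * (f2 y * f0 (- y) + f1 y * (f1 (- y) * (-1)) +
        (f1 y * f1 (- y) + f0 y * (f2 (- y) * (-1))))) (at y)"
      unfolding W_def by (auto intro!: derivative_eq_intros f_deriv)
    moreover have "(exp (- (y\<^sup>2 / 2)) * (- y)) * (f1 y * f0 (- y) + f0 y * f1 (- y)) +
      exp (- (y\<^sup>2 / 2)) * (f2 y * f0 (- y) + f1 y * (f1 (- y) * (-1)) +
        (f1 y * f1 (- y) + f0 y * (f2 (- y) * (-1)))) = 0"
      unfolding f2_eq by algebra
    ultimately show ?thesis by simp
  qed
  then have "W y = W 0" for y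
    by (rule DERIV_isconst_all[rule_format])
  moreover have "W 0 > 0"
    using f_pos by (simp add: W_def add_pos_pos)
  ultimately show ?thesis
    by (intro that[of "W 0"]) (auto simp: W_def)
qed

text \<open>This is the supporting line at z of the gain in the scale given by the quotient of the two
  fundamental solutions.\<close>

lemma supporting_combination:
  assumes b: "gain_wronskian b = 0" "\<And>y. y < b \<Longrightarrow> gain_wronskian y > 0"
    "\<And>y z. b \<le> y \<Longrightarrow> y < z \<Longrightarrow> gain_wronskian z < gain_wronskian y"
    and z: "b \<le> z"
  obtains p q where "p \<ge> 0" "q \<ge> 0" "p * f0 z + q * f0 (- z) = gain z"
    "\<And>y. gain y \<le> p * f0 y + q * f0 (- y)" "z = b \<Longrightarrow> q = 0"
proof -
  obtain w where w: "w > 0" "\<And>y. exp (- (y\<^sup>2 / 2)) * (f1 y * f0 (- y) + f0 y * f1 (- y)) = w"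
    using wronskian_const by blast
  \<comment> \<open>Tangency at z forces this value: the weighted Wronskian of p f(y) + q f(-y) with
    f is the constant -q w, and it has to agree with that of the gain at z. It is nonnegative since
    z lies at or beyond b, and zero at b.\<close>
  define q where "q = - gain_wronskian z / w"
  have "gain_wronskian z \<le> 0"
    using b(1) b(3)[of b z] z by (cases "b = z") auto
  then have q: "q \<ge> 0"
    using w(1) by (simp add: q_def divide_nonpos_pos)
  \<comment> \<open>Domination of the gain by p f(y) + q f(-y) means Q \<ge> -p everywhere, so
    everything reduces to Q attaining its minimum at z.\<close>
  define Q where "Q = (\<lambda>y. (q * f0 (- y) - gain y) / f0 y)"
  define p where "p = - Q z"
  have DQ: "(Q has_field_derivative exp (y\<^sup>2 / 2) * (gain_wronskian z - gain_wronskian y) / (f0 y * f0 y)) (at y)" for y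
  proof -
    have "(Q has_field_derivative
      ((q * (f1 (- y) * (-1)) - \<kappa> * exp (\<theta> + \<kappa> * y)) * f0 y
        - (q * f0 (- y) - gain y) * f1 y) / (f0 y * f0 y)) (at y)"
      unfolding Q_def using f_pos(1)[of y]
      by (auto intro!: derivative_eq_intros f_deriv gain_has_derivative)
    moreover have "(q * (f1 (- y) * (-1)) - \<kappa> * exp (\<theta> + \<kappa> * y)) * f0 y
        - (q * f0 (- y) - gain y) * f1 y = exp (y\<^sup>2 / 2) * (gain_wronskian z - gain_wronskian y)"
    proof -
      have "gain_wronskian z = - q * (exp (- (y\<^sup>2 / 2)) * (f1 y * f0 (- y) + f0 y * f1 (- y)))"
        unfolding w(2) using w(1) by (simp add: q_def)
      moreover have "exp (y\<^sup>2 / 2) * exp (- (y\<^sup>2 / 2)) = 1"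
        by (simp only: exp_minus_inverse)
      ultimately show ?thesis
        unfolding gain_wronskian_def[of y] by algebra
    qed
    ultimately show ?thesis by simp
  qed
  \<comment> \<open>The sign of Q' at x is that of the Wronskian at z minus the Wronskian at x. Left
    of z the latter is larger, being positive below b and decreasing from b on; right of z it is
    smaller.\<close>
  have Q_min: "Q z \<le> Q y" for y
  proof (cases "y \<le> z")
    case True
    show ?thesis
    proof (rule DERIV_nonpos_imp_nonincreasing[OF True])
      fix x assume x: "y \<le> x" "x \<le> z"
      have "gain_wronskian z \<le> gain_wronskian x"
      proof (cases "x < b")
        case True
        then show ?thesis
          using b(2)[of x] \<open>gain_wronskian z \<le> 0\<close> by simp
      next
        case False
        then show ?thesis
          using b(3)[of x z] x by (cases "x = z") auto
      qed
      then have "exp (x\<^sup>2 / 2) * (gain_wronskian z - gain_wronskian x) / (f0 x * f0 x) \<le> 0"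
        by (simp add: divide_nonpos_nonneg mult_nonneg_nonpos)
      then show "\<exists>d. (Q has_field_derivative d) (at x) \<and> d \<le> 0"
        using DQ[of x] by blast
    qed
  next
    case False
    then have "z \<le> y" by simp
    then show ?thesis
    proof (rule DERIV_nonneg_imp_nondecreasing)
      fix x assume x: "z \<le> x" "x \<le> y"
      have "gain_wronskian x \<le> gain_wronskian z"
        using b(3)[of z x] x z by (cases "x = z") auto
      then have "exp (x\<^sup>2 / 2) * (gain_wronskian z - gain_wronskian x) / (f0 x * f0 x) \<ge> 0"
        by simp
      then show "\<exists>d. (Q has_field_derivative d) (at x) \<and> 0 \<le> d"
        using DQ[of x] by blast
    qed
  qed
  show ?thesis
  proof (rule that[of p q])
    show "q \<ge> 0" by fact
    show "q = 0" if "z = b"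
      using b(1) that by (simp add: q_def)
    show "p * f0 z + q * f0 (- z) = gain z"
      using f_pos(1)[of z] by (simp add: p_def Q_def)
    show "gain y \<le> p * f0 y + q * f0 (- y)" for y
      using Q_min[of y] f_pos(1)[of y] by (simp add: p_def Q_def pos_le_divide_eq algebra_simps)
    show "p \<ge> 0"
    proof -
      have "gain b * f1 b = \<kappa> * exp (\<theta> + \<kappa> * b) * f0 b"
        using b(1) by (simp add: gain_wronskian_def)
      then have "gain b > 0"
        using f_pos[of b] kappa_pos by (metis exp_gt_zero mult_pos_pos zero_less_mult_pos2)
      then have "gain z > 0"
        using gain_mono[OF z] by simp
      \<comment> \<open>Cramer's rule for value and slope at z: p W = g f'(-z) + g' f(-z), where f'
        means \<open>f1\<close> and g, g' are the gain and its slope at z. The right side is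
        positive because smooth fit makes the gain positive at b, hence at z.\<close>
      define W where "W = f1 z * f0 (- z) + f0 z * f1 (- z)"
      have W: "W > 0"
        using f_pos by (simp add: W_def add_pos_pos)
      have "exp (- (z\<^sup>2 / 2)) * (q * W) = q * w"
        unfolding W_def w(2)[of z, symmetric] by (simp only: mult.left_commute)
      also have "\<dots> = - gain_wronskian z"
        using w(1) by (simp add: q_def)
      finally have "exp (- (z\<^sup>2 / 2)) * (q * W) = - gain_wronskian z" .
      then have "exp (- (z\<^sup>2 / 2)) * (q * W) = exp (- (z\<^sup>2 / 2)) * (gain z * f1 z - \<kappa> * exp (\<theta> + \<kappa> * z) * f0 z)"
        unfolding gain_wronskian_def by (simp add: algebra_simps)
      then have qW: "q * W = gain z * f1 z - \<kappa> * exp (\<theta> + \<kappa> * z) * f0 z"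
        by simp
      have "p * f0 z = gain z - q * f0 (- z)"
        using f_pos(1)[of z] by (simp add: p_def Q_def)
      then have "(p * W) * f0 z = (gain z * f1 (- z) + \<kappa> * exp (\<theta> + \<kappa> * z) * f0 (- z)) * f0 z"
        using qW unfolding W_def by algebra
      then have "p * W = gain z * f1 (- z) + \<kappa> * exp (\<theta> + \<kappa> * z) * f0 (- z)"
        using f_pos(1)[of z] by simp
      also have "\<dots> > 0"
        using \<open>gain z > 0\<close> kappa_pos f_pos by (simp add: add_pos_pos)
      finally show ?thesis
        using W by (simp add: zero_less_mult_iff)
    qed
  qed
qed

end

section \<open>Exponential moments of Brownian increments\<close>

text \<open>Bounded second moments give uniform integrability, hence convergence of expectations.
  The upper bound is Fatou; for the lower one, Z \<le> min Z K + Z^2/K costs at most C/K, bounded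
  convergence treats the truncation, and K tends to infinity.\<close>

lemma (in prob_space) nn_integral_LIMSEQ_L2_bounded:
  fixes Z :: "nat \<Rightarrow> 'a \<Rightarrow> real"
  assumes meas [measurable]: "\<And>n. Z n \<in> borel_measurable M"
    and nonneg: "\<And>n \<omega>. \<omega> \<in> space M \<Longrightarrow> 0 \<le> Z n \<omega>"
    and conv: "\<And>\<omega>. \<omega> \<in> space M \<Longrightarrow> (\<lambda>n. Z n \<omega>) \<longlonglongrightarrow> Y \<omega>"
    and L2: "\<And>n. (\<integral>\<^sup>+\<omega>. ennreal ((Z n \<omega>)\<^sup>2) \<partial>M) \<le> ennreal C"
    and C: "C \<ge> 0"
    and lim: "(\<lambda>n. \<integral>\<^sup>+\<omega>. ennreal (Z n \<omega>) \<partial>M) \<longlonglongrightarrow> L"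
  shows "(\<integral>\<^sup>+\<omega>. ennreal (Y \<omega>) \<partial>M) = L"
proof (rule antisym)
  have [measurable]: "Y \<in> borel_measurable M"
    by (rule borel_measurable_LIMSEQ_real[OF conv meas])
  have "(\<integral>\<^sup>+\<omega>. ennreal (Y \<omega>) \<partial>M) = (\<integral>\<^sup>+\<omega>. liminf (\<lambda>n. ennreal (Z n \<omega>)) \<partial>M)"
    by (intro nn_integral_cong lim_imp_Liminf[symmetric] tendsto_ennrealI conv) auto
  also have "\<dots> \<le> liminf (\<lambda>n. \<integral>\<^sup>+\<omega>. ennreal (Z n \<omega>) \<partial>M)"
    by (rule nn_integral_liminf) measurable
  also have "\<dots> = L"
    using lim by (intro lim_imp_Liminf) auto
  finally show "(\<integral>\<^sup>+\<omega>. ennreal (Y \<omega>) \<partial>M) \<le> L" .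
  have le: "L \<le> (\<integral>\<^sup>+\<omega>. ennreal (Y \<omega>) \<partial>M) + ennreal (C / real (Suc k))" for k
  proof -
    let ?K = "real (Suc k)"
    have "(\<lambda>n. \<integral>\<^sup>+\<omega>. ennreal (min (Z n \<omega>) ?K) \<partial>M) \<longlonglongrightarrow> (\<integral>\<^sup>+\<omega>. ennreal (min (Y \<omega>) ?K) \<partial>M)"
    proof (rule nn_integral_dominated_convergence[where w = "\<lambda>_. ennreal ?K"])
      show "AE \<omega> in M. (\<lambda>n. ennreal (min (Z n \<omega>) ?K)) \<longlonglongrightarrow> ennreal (min (Y \<omega>) ?K)"
        by (intro AE_I2 tendsto_ennrealI tendsto_min conv tendsto_const)
    qed (auto intro!: AE_I2 ennreal_leI simp: emeasure_space_1 simp del: of_nat_Suc)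
    then have "(\<lambda>n. (\<integral>\<^sup>+\<omega>. ennreal (min (Z n \<omega>) ?K) \<partial>M) + ennreal (C / ?K))
      \<longlonglongrightarrow> (\<integral>\<^sup>+\<omega>. ennreal (min (Y \<omega>) ?K) \<partial>M) + ennreal (C / ?K)"
      by (intro tendsto_add tendsto_const)
    then have "L \<le> (\<integral>\<^sup>+\<omega>. ennreal (min (Y \<omega>) ?K) \<partial>M) + ennreal (C / ?K)"
    proof (rule LIMSEQ_le[OF lim], intro exI allI impI)
      fix n
      have "ennreal (Z n \<omega>) \<le> ennreal (min (Z n \<omega>) ?K) + ennreal (1 / ?K) * ennreal ((Z n \<omega>)\<^sup>2)"
        if "\<omega> \<in> space M" for \<omega>
      proof -
        have z: "Z n \<omega> \<ge> 0"
          using nonneg that by simp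
        have "Z n \<omega> \<le> min (Z n \<omega>) ?K + 1 / ?K * (Z n \<omega>)\<^sup>2"
        proof (cases "Z n \<omega> \<le> ?K")
          case False
          then have "Z n \<omega> * ?K \<le> Z n \<omega> * Z n \<omega>"
            using z by (intro mult_left_mono) auto
          then have "Z n \<omega> \<le> Z n \<omega> * Z n \<omega> / ?K"
            by (simp add: pos_le_divide_eq)
          moreover have "0 \<le> min (Z n \<omega>) ?K"
            using z by simp
          ultimately show ?thesis
            unfolding power2_eq_square by (simp del: of_nat_Suc)
        qed simp
        then show ?thesis
          using z by (simp flip: ennreal_plus ennreal_mult' del: of_nat_Suc)
      qed
      then have "(\<integral>\<^sup>+\<omega>. ennreal (Z n \<omega>) \<partial>M) \<le>
        (\<integral>\<^sup>+\<omega>. ennreal (min (Z n \<omega>) ?K) + ennreal (1 / ?K) * ennreal ((Z n \<omega>)\<^sup>2) \<partial>M)"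
        by (rule nn_integral_mono)
      also have "\<dots> = (\<integral>\<^sup>+\<omega>. ennreal (min (Z n \<omega>) ?K) \<partial>M) +
          ennreal (1 / ?K) * (\<integral>\<^sup>+\<omega>. ennreal ((Z n \<omega>)\<^sup>2) \<partial>M)"
        by (simp add: nn_integral_add nn_integral_cmult del: of_nat_Suc)
      also have "\<dots> \<le> (\<integral>\<^sup>+\<omega>. ennreal (min (Z n \<omega>) ?K) \<partial>M) + ennreal (1 / ?K) * ennreal (C)"
        using L2[of n] by (intro add_left_mono mult_left_mono) auto
      also have "ennreal (1 / ?K) * ennreal (C) = ennreal (C / ?K)"
        by (simp flip: ennreal_mult' del: of_nat_Suc)
      finally show "(\<integral>\<^sup>+\<omega>. ennreal (Z n \<omega>) \<partial>M) \<le>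
        (\<integral>\<^sup>+\<omega>. ennreal (min (Z n \<omega>) ?K) \<partial>M) + ennreal (C / ?K)" .
    qed
    also have "\<dots> \<le> (\<integral>\<^sup>+\<omega>. ennreal (Y \<omega>) \<partial>M) + ennreal (C / ?K)"
      by (intro add_right_mono nn_integral_mono ennreal_leI) simp
    finally show ?thesis .
  qed
  have "(\<lambda>k. C / real (Suc k)) \<longlonglongrightarrow> 0"
    by (rule LIMSEQ_Suc[OF lim_const_over_n])
  then have "(\<lambda>k. (\<integral>\<^sup>+\<omega>. ennreal (Y \<omega>) \<partial>M) + ennreal (C / real (Suc k)))
    \<longlonglongrightarrow> (\<integral>\<^sup>+\<omega>. ennreal (Y \<omega>) \<partial>M) + ennreal 0"
    by (intro tendsto_add tendsto_const tendsto_ennrealI)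
  then have "(\<lambda>k. (\<integral>\<^sup>+\<omega>. ennreal (Y \<omega>) \<partial>M) + ennreal (C / real (Suc k)))
    \<longlonglongrightarrow> (\<integral>\<^sup>+\<omega>. ennreal (Y \<omega>) \<partial>M)"
    by simp
  then show "L \<le> (\<integral>\<^sup>+\<omega>. ennreal (Y \<omega>) \<partial>M)"
    by (rule LIMSEQ_le_const) (use le in blast)
qed

text \<open>Exponential tilting: completing the square moves the mean of the normal density to a s^2
  and leaves the stated factor.\<close>

lemma nn_integral_exp_normal:
  assumes D: "distributed M lborel D (normal_density 0 s)" and s: "s > 0"
  shows "(\<integral>\<^sup>+\<omega>. ennreal (exp (a * D \<omega>)) \<partial>M) = ennreal (exp (a\<^sup>2 * s\<^sup>2 / 2))"
proof -
  have "(\<integral>\<^sup>+\<omega>. ennreal (exp (a * D \<omega>)) \<partial>M)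
    = (\<integral>\<^sup>+y. ennreal (normal_density 0 s y) * ennreal (exp (a * y)) \<partial>lborel)"
    by (rule distributed_nn_integral[OF D, symmetric]) measurable
  also have "\<dots> = (\<integral>\<^sup>+y. ennreal (exp (a\<^sup>2 * s\<^sup>2 / 2)) * ennreal (normal_density (a * s\<^sup>2) s y) \<partial>lborel)"
  proof (rule nn_integral_cong)
    fix y
    have "- (y\<^sup>2 / (2 * s\<^sup>2)) + a * y = a\<^sup>2 * s\<^sup>2 / 2 + - ((y - a * s\<^sup>2)\<^sup>2 / (2 * s\<^sup>2))"
      using s by (simp add: field_simps power2_eq_square)
    then have "exp (- (y\<^sup>2 / (2 * s\<^sup>2))) * exp (a * y)
      = exp (a\<^sup>2 * s\<^sup>2 / 2) * exp (- ((y - a * s\<^sup>2)\<^sup>2 / (2 * s\<^sup>2)))"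
      by (simp only: exp_add[symmetric])
    then have "normal_density 0 s y * exp (a * y) = exp (a\<^sup>2 * s\<^sup>2 / 2) * normal_density (a * s\<^sup>2) s y"
      by (simp add: normal_density_def)
    then show "ennreal (normal_density 0 s y) * ennreal (exp (a * y)) =
      ennreal (exp (a\<^sup>2 * s\<^sup>2 / 2)) * ennreal (normal_density (a * s\<^sup>2) s y)"
      by (simp flip: ennreal_mult')
  qed
  also have "\<dots> = ennreal (exp (a\<^sup>2 * s\<^sup>2 / 2)) * (\<integral>\<^sup>+y. ennreal (normal_density (a * s\<^sup>2) s y) \<partial>lborel)"
    by (rule nn_integral_cmult) measurable
  also have "(\<integral>\<^sup>+y. ennreal (normal_density (a * s\<^sup>2) s y) \<partial>lborel) = 1"
    using s by (simp add: nn_integral_eq_integral)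
  finally show ?thesis by simp
qed

section \<open>The natural filtration and independence of increments\<close>

lemma space_nat_filtration [simp]: "space (nat_filtration M B t) = space M"
  unfolding nat_filtration_def by (rule space_measure_of) auto

lemma sets_nat_filtration:
  "sets (nat_filtration M B t) = sigma_sets (space M)
     {{\<omega> \<in> space M. B u \<omega> \<in> A} | u A. 0 \<le> u \<and> ennreal u \<le> t \<and> A \<in> sets borel}"
  unfolding nat_filtration_def by (rule sets_measure_of) auto

lemma sets_nat_filtration_mono:
  "s \<le> t \<Longrightarrow> sets (nat_filtration M B s) \<subseteq> sets (nat_filtration M B t)"
  unfolding sets_nat_filtration by (rule sigma_sets_mono') (auto intro: order_trans)

lemma measurable_nat_filtration_mono:
  "s \<le> t \<Longrightarrow> f \<in> nat_filtration M B s \<rightarrow>\<^sub>M N \<Longrightarrow> f \<in> nat_filtration M B t \<rightarrow>\<^sub>M N"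
  using sets_nat_filtration_mono[of s t M B] by (auto simp: measurable_def)

lemma measurable_nat_filtration_self:
  "0 \<le> u \<Longrightarrow> ennreal u \<le> t \<Longrightarrow> B u \<in> borel_measurable (nat_filtration M B t)"
  by (rule measurableI) (auto simp: sets_nat_filtration vimage_def Int_def intro!: sigma_sets.Basic)

locale brownian_motion =
  fixes M :: "'a measure" and B :: "real \<Rightarrow> 'a \<Rightarrow> real"
  assumes std_bm: "std_brownian_motion M B"
begin

abbreviation "\<F> t \<equiv> nat_filtration M B (ennreal t)"

sublocale prob_space M
  using std_bm by (simp add: std_brownian_motion_def)

lemma B_measurable [measurable]: "t \<ge> 0 \<Longrightarrow> B t \<in> borel_measurable M"
  using std_bm by (simp add: std_brownian_motion_def)

lemma sets_filtration_subset: "sets (nat_filtration M B t) \<subseteq> sets M"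
proof -
  have "{\<omega> \<in> space M. B u \<omega> \<in> A} \<in> sets M" if "0 \<le> u" "A \<in> sets borel" for u A
    using B_measurable[OF that(1)] that(2) by measurable
  then show ?thesis
    unfolding sets_nat_filtration by (intro sets.sigma_sets_subset) auto
qed

lemma filtration_measurable: "f \<in> nat_filtration M B t \<rightarrow>\<^sub>M N \<Longrightarrow> f \<in> M \<rightarrow>\<^sub>M N"
  using sets_filtration_subset[of t] by (auto simp: measurable_def)

lemma nn_integral_exp_increment:
  assumes Z: "Z \<in> borel_measurable (\<F> s)" and st: "0 \<le> s" "s \<le> t"
  shows "(\<integral>\<^sup>+\<omega>. Z \<omega> * ennreal (exp (a * (B t \<omega> - B s \<omega>))) \<partial>M)
    = (\<integral>\<^sup>+\<omega>. Z \<omega> \<partial>M) * ennreal (exp (a\<^sup>2 * (t - s) / 2))"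
\<comment> \<open>The increment has a normal density only for s < t; for s = t both exponential
  factors are 1.\<close>
proof (cases "s = t")
  case False
  with st have "s < t" by simp
  define U where "U = (\<lambda>\<omega>. ennreal (exp (a * (B t \<omega> - B s \<omega>))))"
  have [measurable]: "B t \<in> borel_measurable M" "B s \<in> borel_measurable M"
    using st by auto
  \<comment> \<open>Independence is given between event families; preimages under the exponential of
    the increment lie in the first family and preimages under Z in the second, so the two variables
    inherit it.\<close>
  have "indep_vars (\<lambda>_. borel) (case_bool U Z) UNIV"
    unfolding indep_vars_def2
  proof (intro conjI ballI)
    show "case_bool U Z i \<in> borel_measurable M" for i
      using filtration_measurable[OF Z] by (cases i) (auto simp: U_def)
    have "indep_sets (case_bool {{\<omega> \<in> space M. B t \<omega> - B s \<omega> \<in> A} | A. A \<in> sets borel}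
          (sets (\<F> s))) UNIV"
      using std_bm st by (simp add: std_brownian_motion_def indep_set_def)
    then show "indep_sets (\<lambda>i. {case_bool U Z i -` A \<inter> space M |A. A \<in> sets borel}) UNIV"
    proof (rule indep_sets_mono_sets)
      fix i
      have "\<exists>A'. {\<omega> \<in> space M. U \<omega> \<in> A} = {\<omega> \<in> space M. B t \<omega> - B s \<omega> \<in> A'} \<and> A' \<in> sets borel"
        if "A \<in> sets borel" for A
        using that measurable_sets[of "\<lambda>d. ennreal (exp (a * d))" borel borel A]
        by (intro exI[of _ "(\<lambda>d. ennreal (exp (a * d))) -` A"]) (auto simp: U_def)
      moreover have "Z -` A \<inter> space M \<in> sets (\<F> s)" if "A \<in> sets borel" for A
        using measurable_sets[OF Z that] by simp
      ultimately show "{case_bool U Z i -` A \<inter> space M |A. A \<in> sets borel}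
        \<subseteq> (case i of True \<Rightarrow> {{\<omega> \<in> space M. B t \<omega> - B s \<omega> \<in> A} | A. A \<in> sets borel}
            | False \<Rightarrow> sets (\<F> s))"
        by (cases i) (auto simp: vimage_def Int_def conj_commute)
    qed
  qed
  then have "(\<integral>\<^sup>+\<omega>. (\<Prod>i\<in>UNIV. case_bool U Z i \<omega>) \<partial>M) = (\<Prod>i\<in>UNIV. \<integral>\<^sup>+\<omega>. case_bool U Z i \<omega> \<partial>M)"
    by (intro indep_vars_nn_integral) auto
  then have "(\<integral>\<^sup>+\<omega>. Z \<omega> * U \<omega> \<partial>M) = (\<integral>\<^sup>+\<omega>. Z \<omega> \<partial>M) * (\<integral>\<^sup>+\<omega>. U \<omega> \<partial>M)"
    by (simp add: UNIV_bool mult.commute)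
  also have "(\<integral>\<^sup>+\<omega>. U \<omega> \<partial>M) = ennreal (exp (a\<^sup>2 * (t - s) / 2))"
    using nn_integral_exp_normal[of M "\<lambda>\<omega>. B t \<omega> - B s \<omega>" "sqrt (t - s)" a] std_bm \<open>s < t\<close> st
    by (simp add: std_brownian_motion_def U_def)
  finally show ?thesis
    by (simp add: U_def)
qed simp

text \<open>The last increment is peeled off: everything before it is measurable at time
  \<open>u n\<close> and takes the role of Z. The general weight Z is kept for the later martingale
  property, where it carries the event A.\<close>

lemma nn_integral_exp_weighted_increments:
  assumes Z: "Z \<in> borel_measurable (\<F> (u 0))" and u: "0 \<le> u 0" "incseq u"
  shows "(\<integral>\<^sup>+\<omega>. Z \<omega> * ennreal (exp (\<Sum>i<n. a i * (B (u (Suc i)) \<omega> - B (u i) \<omega>))) \<partial>M)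
    = (\<integral>\<^sup>+\<omega>. Z \<omega> \<partial>M) * ennreal (exp (\<Sum>i<n. (a i)\<^sup>2 * (u (Suc i) - u i) / 2))"
proof (induction n)
  case (Suc n)
  define S where "S = (\<lambda>\<omega>. \<Sum>i<n. a i * (B (u (Suc i)) \<omega> - B (u i) \<omega>))"
  have u0: "u 0 \<le> u i" "0 \<le> u i" for i
    using u by (auto simp: incseq_def intro: order_trans)
  have Zn: "(\<lambda>\<omega>. Z \<omega> * ennreal (exp (S \<omega>))) \<in> borel_measurable (\<F> (u n))"
  proof -
    have [measurable]: "Z \<in> borel_measurable (\<F> (u n))"
      by (rule measurable_nat_filtration_mono[OF _ Z]) (simp add: u0 ennreal_leI)
    have "(\<lambda>\<omega>. B (u (Suc i)) \<omega> - B (u i) \<omega>) \<in> borel_measurable (\<F> (u n))" if "i < n" for i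
    proof -
      have "u (Suc i) \<le> u n" "u i \<le> u n"
        using u(2) that by (auto simp: incseq_def)
      then show ?thesis
        by (intro borel_measurable_diff measurable_nat_filtration_self) (auto simp: u0 ennreal_leI)
    qed
    then have [measurable]: "S \<in> borel_measurable (\<F> (u n))"
      unfolding S_def by (intro borel_measurable_sum borel_measurable_times borel_measurable_const) auto
    show ?thesis by measurable
  qed
  have "(\<integral>\<^sup>+\<omega>. Z \<omega> * ennreal (exp (\<Sum>i<Suc n. a i * (B (u (Suc i)) \<omega> - B (u i) \<omega>))) \<partial>M)
    = (\<integral>\<^sup>+\<omega>. (Z \<omega> * ennreal (exp (S \<omega>))) * ennreal (exp (a n * (B (u (Suc n)) \<omega> - B (u n) \<omega>))) \<partial>M)"
    by (simp add: S_def exp_add ennreal_mult' mult.assoc)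
  also have "\<dots> = (\<integral>\<^sup>+\<omega>. Z \<omega> * ennreal (exp (S \<omega>)) \<partial>M) * ennreal (exp ((a n)\<^sup>2 * (u (Suc n) - u n) / 2))"
    using u(2) by (intro nn_integral_exp_increment[OF Zn]) (auto simp: u0 incseq_Suc_iff)
  also have "\<dots> = (\<integral>\<^sup>+\<omega>. Z \<omega> \<partial>M) * ennreal (exp (\<Sum>i<Suc n. (a i)\<^sup>2 * (u (Suc i) - u i) / 2))"
    unfolding S_def Suc.IH by (simp add: exp_add ennreal_mult' mult.assoc)
  finally show ?case .
qed simp

end

section \<open>Riemann sums along uniform grids\<close>

text \<open>There are Suc n cells, so the mesh is defined for n = 0 too. The points continue past t,
  which makes the grid an increasing sequence on all indices, as the product formula for increments
  wants.\<close>

definition grid :: "real \<Rightarrow> real \<Rightarrow> nat \<Rightarrow> nat \<Rightarrow> real" where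
  "grid s t n i = s + real i * ((t - s) / real (Suc n))"

lemma grid_0 [simp]: "grid s t n 0 = s"
  by (simp add: grid_def)

lemma grid_last [simp]: "grid s t n (Suc n) = t"
  by (simp add: grid_def del: of_nat_Suc)

lemma grid_Suc: "grid s t n (Suc i) = grid s t n i + (t - s) / real (Suc n)"
  unfolding grid_def of_nat_Suc[of i] by (simp only: distrib_right mult_1_left add.assoc add.commute)

lemma incseq_grid: "s \<le> t \<Longrightarrow> incseq (grid s t n)"
  by (simp add: incseq_Suc_iff grid_Suc del: of_nat_Suc)

lemma grid_mem: "s \<le> t \<Longrightarrow> i \<le> Suc n \<Longrightarrow> grid s t n i \<in> {s..t}"
  using incseq_grid[of s t n, THEN incseqD, of 0 i] incseq_grid[of s t n, THEN incseqD, of i "Suc n"]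
  by simp

text \<open>D is a local approximation to the increments of A. An error of \<epsilon> times the cell
  length sums to \<epsilon> (t - s) by telescoping.\<close>

lemma LIMSEQ_sum_grid:
  fixes A :: "real \<Rightarrow> real" and D :: "real \<Rightarrow> real \<Rightarrow> real"
  assumes st: "s \<le> t"
    and close: "\<And>\<epsilon>. \<epsilon> > 0 \<Longrightarrow> \<exists>\<delta>>0. \<forall>u v. s \<le> u \<longrightarrow> u \<le> v \<longrightarrow> v \<le> t \<longrightarrow> v - u < \<delta> \<longrightarrow>
      \<bar>A v - A u - D u v\<bar> \<le> \<epsilon> * (v - u)"
  shows "(\<lambda>n. \<Sum>i<Suc n. D (grid s t n i) (grid s t n (Suc i))) \<longlonglongrightarrow> A t - A s"
proof (rule LIMSEQ_I)
  fix e :: real assume e: "e > 0"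
  \<comment> \<open>The added 1 covers the degenerate interval t = s.\<close>
  define \<epsilon> where "\<epsilon> = e / (t - s + 1)"
  have \<epsilon>: "\<epsilon> > 0" "\<epsilon> * (t - s) < e"
    using e st by (auto simp: \<epsilon>_def field_simps)
  obtain \<delta> where \<delta>: "\<delta> > 0" "\<And>u v. s \<le> u \<Longrightarrow> u \<le> v \<Longrightarrow> v \<le> t \<Longrightarrow> v - u < \<delta> \<Longrightarrow>
      \<bar>A v - A u - D u v\<bar> \<le> \<epsilon> * (v - u)"
    using close[OF \<epsilon>(1)] by metis
  have "(\<lambda>n. (t - s) / real (Suc n)) \<longlonglongrightarrow> 0"
    by (rule LIMSEQ_Suc[OF lim_const_over_n])
  then obtain N where N: "\<And>n. n \<ge> N \<Longrightarrow> \<bar>(t - s) / real (Suc n)\<bar> < \<delta>"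
    using LIMSEQ_D[OF _ \<delta>(1)] by (metis diff_zero real_norm_def)
  show "\<exists>no. \<forall>n\<ge>no. norm ((\<Sum>i<Suc n. D (grid s t n i) (grid s t n (Suc i))) - (A t - A s)) < e"
  proof (intro exI allI impI)
    fix n assume n: "n \<ge> N"
    let ?g = "grid s t n"
    have "A t - A s = (\<Sum>i<Suc n. A (?g (Suc i)) - A (?g i))"
      by (subst sum_lessThan_telescope) simp
    then have "(\<Sum>i<Suc n. D (?g i) (?g (Suc i))) - (A t - A s)
      = - (\<Sum>i<Suc n. A (?g (Suc i)) - A (?g i) - D (?g i) (?g (Suc i)))"
      by (simp only: sum_subtractf)
    then have "norm ((\<Sum>i<Suc n. D (?g i) (?g (Suc i))) - (A t - A s))
      \<le> (\<Sum>i<Suc n. \<bar>A (?g (Suc i)) - A (?g i) - D (?g i) (?g (Suc i))\<bar>)"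
      by (simp only: real_norm_def abs_minus_cancel sum_abs)
    also have "\<dots> \<le> (\<Sum>i<Suc n. \<epsilon> * (?g (Suc i) - ?g i))"
    proof (rule sum_mono)
      fix i assume "i \<in> {..<Suc n}"
      then show "\<bar>A (?g (Suc i)) - A (?g i) - D (?g i) (?g (Suc i))\<bar> \<le> \<epsilon> * (?g (Suc i) - ?g i)"
        using grid_mem[OF st, of i n] grid_mem[OF st, of "Suc i" n] incseq_grid[OF st, of n] N[OF n]
        by (intro \<delta>(2)) (auto simp: incseq_Suc_iff grid_Suc simp del: of_nat_Suc)
    qed
    also have "\<dots> = \<epsilon> * (t - s)"
      by (simp only: sum_distrib_left[symmetric] sum_lessThan_telescope grid_0 grid_last)
    finally show "norm ((\<Sum>i<Suc n. D (?g i) (?g (Suc i))) - (A t - A s)) < e"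
      using \<epsilon>(2) by simp
  qed
qed

text \<open>The local error is an integral over the cell of a difference of values of H at points
  one mesh apart, so uniform continuity on the square makes it small. H has two arguments because
  the product rule leaves its two factors at different times.\<close>

lemma LIMSEQ_sum_grid_integral:
  fixes A :: "real \<Rightarrow> real" and D :: "real \<Rightarrow> real \<Rightarrow> real" and H :: "real \<times> real \<Rightarrow> real"
  assumes st: "s \<le> t"
    and H: "continuous_on ({s..t} \<times> {s..t}) H"
    and int: "\<And>u v. s \<le> u \<Longrightarrow> u \<le> v \<Longrightarrow> v \<le> t \<Longrightarrow>
      ((\<lambda>w. H (w, v) - H (u, w)) has_integral (A v - A u - D u v)) {u..v}"
  shows "(\<lambda>n. \<Sum>i<Suc n. D (grid s t n i) (grid s t n (Suc i))) \<longlonglongrightarrow> A t - A s"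
proof (rule LIMSEQ_sum_grid[OF st])
  fix \<epsilon> :: real assume \<epsilon>: "\<epsilon> > 0"
  have "uniformly_continuous_on ({s..t} \<times> {s..t}) H"
    using H by (intro compact_uniformly_continuous compact_Times compact_Icc)
  then obtain d where d: "d > 0" "\<And>p q. p \<in> {s..t} \<times> {s..t} \<Longrightarrow> q \<in> {s..t} \<times> {s..t} \<Longrightarrow>
      dist q p < d \<Longrightarrow> dist (H q) (H p) < \<epsilon>"
    using \<epsilon> unfolding uniformly_continuous_on_def by metis
  show "\<exists>\<delta>>0. \<forall>u v. s \<le> u \<longrightarrow> u \<le> v \<longrightarrow> v \<le> t \<longrightarrow> v - u < \<delta> \<longrightarrow>
      \<bar>A v - A u - D u v\<bar> \<le> \<epsilon> * (v - u)"
  \<comment> \<open>Each of the two coordinates moves by less than the mesh, hence half of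
    d.\<close>
  proof (intro exI[of _ "d / 2"] conjI allI impI)
    fix u v assume uv: "s \<le> u" "u \<le> v" "v \<le> t" "v - u < d / 2"
    have "norm (A v - A u - D u v) \<le> \<epsilon> * measure lborel (cbox u v)"
    proof (rule has_integral_bound)
      show "((\<lambda>w. H (w, v) - H (u, w)) has_integral (A v - A u - D u v)) (cbox u v)"
        using int uv by simp
      fix w assume w: "w \<in> cbox u v"
      have "dist (w, v) (u, w) \<le> dist w u + dist v w"
        unfolding dist_prod_def by (simp add: sqrt_sum_squares_le_sum)
      also have "\<dots> < d"
        using w uv by (auto simp: dist_real_def)
      finally show "norm (H (w, v) - H (u, w)) \<le> \<epsilon>"
        using d(2)[of "(u, w)" "(w, v)"] w uv by (auto simp: dist_real_def)
    qed (use \<epsilon> in simp)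
    then show "\<bar>A v - A u - D u v\<bar> \<le> \<epsilon> * (v - u)"
      using uv by simp
  qed (use d in simp)
qed

lemma LIMSEQ_riemann_sum_exp:
  fixes k :: real
  assumes "k \<noteq> 0" "s \<le> t"
  shows "(\<lambda>n. \<Sum>i<Suc n. exp (k * grid s t n i) * (grid s t n (Suc i) - grid s t n i))
    \<longlonglongrightarrow> exp (k * t) / k - exp (k * s) / k"
proof (rule LIMSEQ_sum_grid_integral[where D = "\<lambda>u v. exp (k * u) * (v - u)" and H = "\<lambda>(p, q). exp (k * p)"])
  show "continuous_on ({s..t} \<times> {s..t}) (\<lambda>(p, q). exp (k * p))"
    unfolding case_prod_unfold by (intro continuous_intros)
  fix u v :: real assume uv: "u \<le> v"
  have "((\<lambda>w. exp (k * w)) has_integral (exp (k * v) / k - exp (k * u) / k)) {u..v}"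
    using assms uv by (intro fundamental_theorem_of_calculus)
      (auto intro!: derivative_eq_intros simp flip: has_real_derivative_iff_has_vector_derivative)
  moreover have "((\<lambda>w. exp (k * u)) has_integral (exp (k * u) * (v - u))) {u..v}"
    using has_integral_const_real[of "exp (k * u)" u v] uv by (simp add: mult.commute)
  ultimately show "((\<lambda>w. (case (w, v) of (p, q) \<Rightarrow> exp (k * p)) - (case (u, w) of (p, q) \<Rightarrow> exp (k * p)))
     has_integral (exp (k * v) / k - exp (k * u) / k - exp (k * u) * (v - u))) {u..v}"
    by (simp add: has_integral_diff)
qed fact

text \<open>Variation of constants, with the stochastic integral replaced by a pathwise limit of
  Riemann sums.\<close>

lemma LIMSEQ_weighted_noise:
  fixes x b :: "real \<Rightarrow> real"
  assumes cont: "continuous_on {0..} x"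
    and eq: "\<And>t. t \<ge> 0 \<Longrightarrow> x t = x0 + integral {0..t} (\<lambda>s. \<mu> * (\<theta> - x s)) + \<sigma> * b t"
    and st: "0 \<le> s" "s \<le> t"
  shows "(\<lambda>n. \<Sum>i<Suc n. exp (\<mu> * grid s t n i) * (\<sigma> * (b (grid s t n (Suc i)) - b (grid s t n i))))
    \<longlonglongrightarrow> exp (\<mu> * t) * (x t - \<theta>) - exp (\<mu> * s) * (x s - \<theta>)"
proof (rule LIMSEQ_sum_grid_integral[where D = "\<lambda>u v. exp (\<mu> * u) * (\<sigma> * (b v - b u))"
      and A = "\<lambda>t. exp (\<mu> * t) * (x t - \<theta>)" and H = "\<lambda>(p, q). \<mu> * (exp (\<mu> * p) * (x q - \<theta>))"])
  have "continuous_on ({s..t} \<times> {s..t}) (\<lambda>p. x (snd p))"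
    by (rule continuous_on_compose2[OF cont]) (use st in \<open>auto intro!: continuous_intros\<close>)
  then show "continuous_on ({s..t} \<times> {s..t}) (\<lambda>(p, q). \<mu> * (exp (\<mu> * p) * (x q - \<theta>)))"
    unfolding case_prod_unfold by (intro continuous_intros)
  fix u v assume uv: "s \<le> u" "u \<le> v" "v \<le> t"
  have int: "(\<lambda>s. \<mu> * (\<theta> - x s)) integrable_on {p..q}" if "0 \<le> p" for p q
    by (intro integrable_continuous_real continuous_intros continuous_on_subset[OF cont]) (use that in auto)
  have "integral {0..u} (\<lambda>s. \<mu> * (\<theta> - x s)) + integral {u..v} (\<lambda>s. \<mu> * (\<theta> - x s))
    = integral {0..v} (\<lambda>s. \<mu> * (\<theta> - x s))"
    using st uv by (intro Henstock_Kurzweil_Integration.integral_combine int) auto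
  then have "integral {u..v} (\<lambda>s. \<mu> * (\<theta> - x s)) = x v - x u - \<sigma> * (b v - b u)"
    using eq[of u] eq[of v] st uv by (simp add: algebra_simps)
  then have "((\<lambda>s. \<mu> * (\<theta> - x s)) has_integral (x v - x u - \<sigma> * (b v - b u))) {u..v}"
    using integrable_integral[OF int[of u v]] st uv by simp
  then have 1: "((\<lambda>w. exp (\<mu> * u) * (\<mu> * (\<theta> - x w))) has_integral
      exp (\<mu> * u) * (x v - x u - \<sigma> * (b v - b u))) {u..v}"
    by (rule has_integral_mult_right)
  have "((\<lambda>w. exp (\<mu> * w) * \<mu>) has_integral (exp (\<mu> * v) - exp (\<mu> * u))) {u..v}"
    using uv by (intro fundamental_theorem_of_calculus)
      (auto intro!: derivative_eq_intros simp flip: has_real_derivative_iff_has_vector_derivative)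
  then have 2: "((\<lambda>w. (exp (\<mu> * w) * \<mu>) * (x v - \<theta>)) has_integral
      (exp (\<mu> * v) - exp (\<mu> * u)) * (x v - \<theta>)) {u..v}"
    by (rule has_integral_mult_left)
  \<comment> \<open>Discrete product rule: the increment of the exponential meets x at the right
    end, the increment of x meets the exponential at the left end. Subtracting the noise leaves only
    drift integrals.\<close>
  have "exp (\<mu> * v) * (x v - \<theta>) - exp (\<mu> * u) * (x u - \<theta>) - exp (\<mu> * u) * (\<sigma> * (b v - b u))
    = (exp (\<mu> * v) - exp (\<mu> * u)) * (x v - \<theta>) + exp (\<mu> * u) * (x v - x u - \<sigma> * (b v - b u))"
    by (simp add: algebra_simps)
  then show "((\<lambda>w. (case (w, v) of (p, q) \<Rightarrow> \<mu> * (exp (\<mu> * p) * (x q - \<theta>)))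
        - (case (u, w) of (p, q) \<Rightarrow> \<mu> * (exp (\<mu> * p) * (x q - \<theta>)))) has_integral
      (exp (\<mu> * v) * (x v - \<theta>) - exp (\<mu> * u) * (x u - \<theta>) - exp (\<mu> * u) * (\<sigma> * (b v - b u)))) {u..v}"
    using has_integral_add[OF 2 1] by (simp add: algebra_simps)
qed (use st in simp)

section \<open>Exponential martingales of the Ornstein-Uhlenbeck process\<close>

locale ou_process = brownian_motion M B
  for M :: "'a measure" and B :: "real \<Rightarrow> 'a \<Rightarrow> real" +
  fixes \<mu> \<theta> \<sigma> :: real and X :: "real \<Rightarrow> real \<Rightarrow> 'a \<Rightarrow> real"
  assumes mu_pos: "\<mu> > 0" and sigma_pos: "\<sigma> > 0"
    and ou: "is_OU_process M B \<mu> \<theta> \<sigma> X"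
begin

lemma X_continuous: "\<omega> \<in> space M \<Longrightarrow> continuous_on {0..} (\<lambda>t. X x t \<omega>)"
  using ou by (simp add: is_OU_process_def)

lemma X_eq: "\<omega> \<in> space M \<Longrightarrow> t \<ge> 0 \<Longrightarrow>
    X x t \<omega> = x + integral {0..t} (\<lambda>s. \<mu> * (\<theta> - X x s \<omega>)) + \<sigma> * B t \<omega>"
  using ou by (simp add: is_OU_process_def)

lemma X_0: "\<omega> \<in> space M \<Longrightarrow> X x 0 \<omega> = x"
  using X_eq[of \<omega> 0 x] std_bm by (simp add: std_brownian_motion_def)

text \<open>Equals x - \<theta> plus the Wiener integral of \<sigma> exp(\<mu> s); written through X
  so that no stochastic integral has to be defined.\<close>

definition Y :: "real \<Rightarrow> real \<Rightarrow> 'a \<Rightarrow> real" where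
  "Y x t \<omega> = exp (\<mu> * t) * (X x t \<omega> - \<theta>)"

definition noise :: "real \<Rightarrow> real \<Rightarrow> nat \<Rightarrow> 'a \<Rightarrow> real" where
  "noise s t n \<omega> = (\<Sum>i<Suc n. exp (\<mu> * grid s t n i) *
     (\<sigma> * (B (grid s t n (Suc i)) \<omega> - B (grid s t n i) \<omega>)))"

text \<open>The variance that the Ito isometry would give: the integral of \<sigma>^2 exp(2 \<mu> u)
  over u from s to t.\<close>

definition noise_var :: "real \<Rightarrow> real \<Rightarrow> real" where
  "noise_var s t = \<sigma>\<^sup>2 * (exp (2 * \<mu> * t) / (2 * \<mu>) - exp (2 * \<mu> * s) / (2 * \<mu>))"

lemma noise_var_add: "noise_var r s + noise_var s t = noise_var r t"
  by (simp add: noise_var_def algebra_simps)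

lemma noise_var_mono: "t \<le> u \<Longrightarrow> noise_var s t \<le> noise_var s u"
  using mu_pos by (auto simp: noise_var_def intro!: mult_left_mono divide_right_mono)

lemma Y_0: "\<omega> \<in> space M \<Longrightarrow> Y x 0 \<omega> = x - \<theta>"
  by (simp add: Y_def X_0)

lemma Y_continuous: "\<omega> \<in> space M \<Longrightarrow> continuous_on {0..} (\<lambda>t. Y x t \<omega>)"
  unfolding Y_def by (intro continuous_intros X_continuous)

lemma noise_LIMSEQ:
  assumes "\<omega> \<in> space M" "0 \<le> s" "s \<le> t"
  shows "(\<lambda>n. noise s t n \<omega>) \<longlonglongrightarrow> Y x t \<omega> - Y x s \<omega>"
  unfolding noise_def Y_def
  by (rule LIMSEQ_weighted_noise[OF X_continuous X_eq]) (use assms in auto)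

lemma noise_measurable:
  assumes "0 \<le> s" "s \<le> t"
  shows "noise s t n \<in> borel_measurable (\<F> t)"
  unfolding noise_def
proof (intro borel_measurable_sum borel_measurable_times borel_measurable_diff borel_measurable_const)
  fix i assume "i \<in> {..<Suc n}"
  then show "B (grid s t n (Suc i)) \<in> borel_measurable (\<F> t)" "B (grid s t n i) \<in> borel_measurable (\<F> t)"
    using grid_mem[of s t i n] grid_mem[of s t "Suc i" n] assms
    by (auto intro!: measurable_nat_filtration_self ennreal_leI)
qed

text \<open>X is only known as a pathwise solution. Adaptedness follows because the approximating
  sums use the Brownian path up to t alone.\<close>

lemma Y_measurable:
  assumes "0 \<le> t"
  shows "Y x t \<in> borel_measurable (\<F> t)"
proof -
  have "(\<lambda>\<omega>. Y x t \<omega> - (x - \<theta>)) \<in> borel_measurable (\<F> t)"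
  proof (rule borel_measurable_LIMSEQ_real)
    show "noise 0 t n \<in> borel_measurable (\<F> t)" for n
      using assms by (intro noise_measurable) auto
    show "(\<lambda>n. noise 0 t n \<omega>) \<longlonglongrightarrow> Y x t \<omega> - (x - \<theta>)" if "\<omega> \<in> space (\<F> t)" for \<omega>
      using noise_LIMSEQ[of \<omega> 0 t x] that assms by (simp add: Y_0)
  qed
  then have "(\<lambda>\<omega>. (Y x t \<omega> - (x - \<theta>)) + (x - \<theta>)) \<in> borel_measurable (\<F> t)"
    by (intro borel_measurable_add borel_measurable_const)
  then show ?thesis
    by simp
qed

lemma X_measurable:
  assumes "0 \<le> t"
  shows "X x t \<in> borel_measurable (\<F> t)"
proof -
  have "X x t = (\<lambda>\<omega>. exp (- (\<mu> * t)) * Y x t \<omega> + \<theta>)"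
    by (intro ext) (simp add: Y_def exp_minus field_simps)
  moreover have "(\<lambda>\<omega>. exp (- (\<mu> * t)) * Y x t \<omega> + \<theta>) \<in> borel_measurable (\<F> t)"
    by (intro borel_measurable_add borel_measurable_times borel_measurable_const Y_measurable assms)
  ultimately show ?thesis
    by simp
qed

lemma nn_integral_exp_noise:
  assumes Z: "Z \<in> borel_measurable (\<F> s)" and st: "0 \<le> s" "s \<le> t"
  shows "(\<integral>\<^sup>+\<omega>. Z \<omega> * ennreal (exp (k * noise s t n \<omega>)) \<partial>M) = (\<integral>\<^sup>+\<omega>. Z \<omega> \<partial>M) *
    ennreal (exp (k\<^sup>2 * (\<sigma>\<^sup>2 * (\<Sum>i<Suc n. exp (2 * \<mu> * grid s t n i) * (grid s t n (Suc i) - grid s t n i))) / 2))"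
proof -
  have Z': "Z \<in> borel_measurable (\<F> (grid s t n 0))"
    using Z by simp
  have 1: "k * noise s t n \<omega> = (\<Sum>i<Suc n. (k * \<sigma> * exp (\<mu> * grid s t n i)) *
      (B (grid s t n (Suc i)) \<omega> - B (grid s t n i) \<omega>))" for \<omega>
    unfolding noise_def sum_distrib_left by (intro sum.cong) (auto simp: ac_simps)
  have "k\<^sup>2 * (\<sigma>\<^sup>2 * (exp (2 * \<mu> * g) * d)) / 2 = (k * \<sigma> * exp (\<mu> * g))\<^sup>2 * d / 2" for g d
  proof -
    have "exp (2 * \<mu> * g) = (exp (\<mu> * g))\<^sup>2"
      by (simp add: exp_double[symmetric] mult.assoc)
    then show ?thesis
      by (simp only: power_mult_distrib mult.assoc)
  qed
  then have 2: "k\<^sup>2 * (\<sigma>\<^sup>2 * (\<Sum>i<Suc n. exp (2 * \<mu> * grid s t n i) * (grid s t n (Suc i) - grid s t n i))) / 2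
    = (\<Sum>i<Suc n. (k * \<sigma> * exp (\<mu> * grid s t n i))\<^sup>2 * (grid s t n (Suc i) - grid s t n i) / 2)"
    by (simp only: sum_distrib_left sum_divide_distrib)
  show ?thesis
    unfolding 1 2
    by (rule nn_integral_exp_weighted_increments[where u = "grid s t n", OF Z']) (use st incseq_grid in auto)
qed

text \<open>The exact formula for the sums passes to the limit by the second-moment lemma: squaring
  doubles k, so the same formula with 2 k and weight Z^2 bounds the second moments.\<close>

lemma nn_integral_exp_Y_increment:
  fixes Z :: "'a \<Rightarrow> real"
  assumes Z: "Z \<in> borel_measurable (\<F> s)" and nonneg: "\<And>\<omega>. Z \<omega> \<ge> 0"
    and L2: "(\<integral>\<^sup>+\<omega>. ennreal ((Z \<omega>)\<^sup>2) \<partial>M) < \<infinity>"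
    and st: "0 \<le> s" "s \<le> t"
  shows "(\<integral>\<^sup>+\<omega>. ennreal (Z \<omega> * exp (k * (Y x t \<omega> - Y x s \<omega>))) \<partial>M)
    = (\<integral>\<^sup>+\<omega>. ennreal (Z \<omega>) \<partial>M) * ennreal (exp (k\<^sup>2 * noise_var s t / 2))"
proof -
  define R where "R = (\<lambda>n. \<sigma>\<^sup>2 * (\<Sum>i<Suc n. exp (2 * \<mu> * grid s t n i) * (grid s t n (Suc i) - grid s t n i)))"
  have R: "R \<longlonglongrightarrow> noise_var s t"
    unfolding R_def noise_var_def using mu_pos st
    by (intro tendsto_mult_left LIMSEQ_riemann_sum_exp) auto
  then obtain K where K: "\<And>n. R n \<le> K"
    by (metis Bseq_def convergentI convergent_imp_Bseq abs_le_D1 real_norm_def)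
  obtain C where C: "C \<ge> 0" "(\<integral>\<^sup>+\<omega>. ennreal ((Z \<omega>)\<^sup>2) \<partial>M) = ennreal C"
    using L2 by (cases "(\<integral>\<^sup>+\<omega>. ennreal ((Z \<omega>)\<^sup>2) \<partial>M)") (auto simp: top_unique)
  show ?thesis
  proof (rule nn_integral_LIMSEQ_L2_bounded[where Z = "\<lambda>n \<omega>. Z \<omega> * exp (k * noise s t n \<omega>)"
        and C = "C * exp (2 * k\<^sup>2 * K)"])
    have [measurable]: "Z \<in> borel_measurable M"
      by (rule filtration_measurable[OF Z])
    have [measurable]: "noise s t n \<in> borel_measurable M" for n
      by (rule filtration_measurable[OF noise_measurable[OF st]])
    show "(\<lambda>\<omega>. Z \<omega> * exp (k * noise s t n \<omega>)) \<in> borel_measurable M" for n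
      by measurable
    show "(\<lambda>n. Z \<omega> * exp (k * noise s t n \<omega>)) \<longlonglongrightarrow> Z \<omega> * exp (k * (Y x t \<omega> - Y x s \<omega>))"
      if "\<omega> \<in> space M" for \<omega>
      using noise_LIMSEQ[OF that st] by (intro tendsto_intros)
    have exp_eq: "(\<integral>\<^sup>+\<omega>. ennreal (Z \<omega> * exp (k * noise s t n \<omega>)) \<partial>M)
      = (\<integral>\<^sup>+\<omega>. ennreal (Z \<omega>) \<partial>M) * ennreal (exp (k\<^sup>2 * R n / 2))" for n
      unfolding R_def using nn_integral_exp_noise[OF measurable_compose[OF Z measurable_ennreal] st, of k n]
      by (simp add: ennreal_mult nonneg)
    \<comment> \<open>Finiteness of the mean of Z is needed to multiply a convergent sequence by it
      among the extended nonnegative reals.\<close>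
    have "(\<integral>\<^sup>+\<omega>. ennreal (Z \<omega>) \<partial>M) \<le> (\<integral>\<^sup>+\<omega>. 1 + ennreal ((Z \<omega>)\<^sup>2) \<partial>M)"
    proof (rule nn_integral_mono)
      fix \<omega>
      have "Z \<omega> \<le> 1 + (Z \<omega>)\<^sup>2"
        using zero_le_power2[of "Z \<omega> - 1"] nonneg[of \<omega>] by (simp add: power2_diff)
      then have "ennreal (Z \<omega>) \<le> ennreal (1 + (Z \<omega>)\<^sup>2)"
        by (rule ennreal_leI)
      then show "ennreal (Z \<omega>) \<le> 1 + ennreal ((Z \<omega>)\<^sup>2)"
        by (simp add: ennreal_plus)
    qed
    also have "\<dots> = 1 + ennreal C"
      by (simp add: nn_integral_add emeasure_space_1 C(2))
    finally have finite: "(\<integral>\<^sup>+\<omega>. ennreal (Z \<omega>) \<partial>M) < top"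
      by (auto simp: less_top[symmetric] top_unique)
    show "(\<lambda>n. \<integral>\<^sup>+\<omega>. ennreal (Z \<omega> * exp (k * noise s t n \<omega>)) \<partial>M)
      \<longlonglongrightarrow> (\<integral>\<^sup>+\<omega>. ennreal (Z \<omega>) \<partial>M) * ennreal (exp (k\<^sup>2 * noise_var s t / 2))"
      unfolding exp_eq
    proof (rule ennreal_tendsto_cmult[OF finite], rule tendsto_ennrealI)
      show "(\<lambda>n. exp (k\<^sup>2 * R n / 2)) \<longlonglongrightarrow> exp (k\<^sup>2 * noise_var s t / 2)"
        by (rule tendsto_exp tendsto_divide tendsto_mult tendsto_const R | simp)+
    qed
    fix n
    have "(\<integral>\<^sup>+\<omega>. ennreal ((Z \<omega> * exp (k * noise s t n \<omega>))\<^sup>2) \<partial>M)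
      = (\<integral>\<^sup>+\<omega>. ennreal ((Z \<omega>)\<^sup>2) * ennreal (exp ((2 * k) * noise s t n \<omega>)) \<partial>M)"
      by (intro nn_integral_cong)
         (simp add: power_mult_distrib exp_double[symmetric] mult.assoc flip: ennreal_mult')
    also have "\<dots> = ennreal C * ennreal (exp ((2 * k)\<^sup>2 * R n / 2))"
      unfolding R_def C(2)[symmetric]
      by (rule nn_integral_exp_noise[OF _ st]) (use Z in measurable)
    also have "\<dots> \<le> ennreal C * ennreal (exp (2 * k\<^sup>2 * K))"
      using K[of n] by (intro mult_left_mono ennreal_leI) (auto simp: power_mult_distrib mult.commute[of _ "k\<^sup>2"] intro!: mult_left_mono)
    finally show "(\<integral>\<^sup>+\<omega>. ennreal ((Z \<omega> * exp (k * noise s t n \<omega>))\<^sup>2) \<partial>M) \<le> ennreal (C * exp (2 * k\<^sup>2 * K))"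
      using C(1) by (simp add: ennreal_mult)
  qed (use nonneg C in auto)
qed

definition exp_martingale :: "real \<Rightarrow> real \<Rightarrow> real \<Rightarrow> 'a \<Rightarrow> real" where
  "exp_martingale k x t \<omega> = exp (k * Y x t \<omega> - k\<^sup>2 * noise_var 0 t / 2)"

lemma exp_martingale_measurable: "0 \<le> t \<Longrightarrow> exp_martingale k x t \<in> borel_measurable (\<F> t)"
  unfolding exp_martingale_def
  using Y_measurable[of t x] by measurable

text \<open>Its finiteness, at 2 k, supplies the second moment required of the weight in the
  martingale property.\<close>

lemma nn_integral_exp_Y:
  assumes "0 \<le> t"
  shows "(\<integral>\<^sup>+\<omega>. ennreal (exp (k * Y x t \<omega>)) \<partial>M) = ennreal (exp (k * (x - \<theta>) + k\<^sup>2 * noise_var 0 t / 2))"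
proof -
  have "(\<integral>\<^sup>+\<omega>. ennreal (exp (k * Y x t \<omega>)) \<partial>M)
    = (\<integral>\<^sup>+\<omega>. ennreal (exp (k * (x - \<theta>)) * exp (k * (Y x t \<omega> - Y x 0 \<omega>))) \<partial>M)"
    by (intro nn_integral_cong) (simp add: Y_0 algebra_simps flip: exp_add)
  also have "\<dots> = (\<integral>\<^sup>+\<omega>. ennreal (exp (k * (x - \<theta>))) \<partial>M) * ennreal (exp (k\<^sup>2 * noise_var 0 t / 2))"
    by (rule nn_integral_exp_Y_increment) (use assms in \<open>auto simp: emeasure_space_1 ennreal_mult_less_top\<close>)
  finally show ?thesis
    by (simp add: emeasure_space_1 exp_add ennreal_mult)
qed

lemma exp_martingale_martingale:
  assumes A: "A \<in> sets (\<F> s)" and st: "0 \<le> s" "s \<le> t"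
  shows "(\<integral>\<^sup>+\<omega>\<in>A. ennreal (exp_martingale k x t \<omega>) \<partial>M) = (\<integral>\<^sup>+\<omega>\<in>A. ennreal (exp_martingale k x s \<omega>) \<partial>M)"
proof -
  \<comment> \<open>All that is known at time s, with the deterministic normaliser of time t. The
    variance over [s, t] gained by the increment turns this normaliser into that of time s.\<close>
  define Z where "Z = (\<lambda>\<omega>. indicator A \<omega> * exp (k * Y x s \<omega> - k\<^sup>2 * noise_var 0 t / 2))"
  have Z: "Z \<in> borel_measurable (\<F> s)"
    unfolding Z_def using Y_measurable[OF st(1), of x] A by measurable
  have "(\<integral>\<^sup>+\<omega>. ennreal ((Z \<omega>)\<^sup>2) \<partial>M) \<le> (\<integral>\<^sup>+\<omega>. ennreal (exp ((2 * k) * Y x s \<omega>)) \<partial>M)"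
  proof (intro nn_integral_mono ennreal_leI)
    fix \<omega>
    have "exp (k * Y x s \<omega> - k\<^sup>2 * noise_var 0 t / 2) \<le> exp (k * Y x s \<omega>)"
      using noise_var_mono[of 0 t 0] st by (simp add: noise_var_def)
    then have "(exp (k * Y x s \<omega> - k\<^sup>2 * noise_var 0 t / 2))\<^sup>2 \<le> (exp (k * Y x s \<omega>))\<^sup>2"
      by (intro power_mono) auto
    then show "(Z \<omega>)\<^sup>2 \<le> exp ((2 * k) * Y x s \<omega>)"
      by (auto simp: Z_def indicator_def mult.assoc exp_double)
  qed
  also have "\<dots> < \<infinity>"
    unfolding nn_integral_exp_Y[OF st(1)] by simp
  finally have L2: "(\<integral>\<^sup>+\<omega>. ennreal ((Z \<omega>)\<^sup>2) \<partial>M) < \<infinity>" .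
  have "(\<integral>\<^sup>+\<omega>\<in>A. ennreal (exp_martingale k x t \<omega>) \<partial>M)
    = (\<integral>\<^sup>+\<omega>. ennreal (Z \<omega> * exp (k * (Y x t \<omega> - Y x s \<omega>))) \<partial>M)"
    by (intro nn_integral_cong)
       (auto simp: Z_def exp_martingale_def indicator_def algebra_simps simp flip: exp_add)
  also have "\<dots> = (\<integral>\<^sup>+\<omega>. ennreal (Z \<omega>) \<partial>M) * ennreal (exp (k\<^sup>2 * noise_var s t / 2))"
    by (rule nn_integral_exp_Y_increment[OF Z _ L2 st]) (simp add: Z_def)
  also have "\<dots> = (\<integral>\<^sup>+\<omega>. ennreal (Z \<omega>) * ennreal (exp (k\<^sup>2 * noise_var s t / 2)) \<partial>M)"
    using filtration_measurable[OF Z] by (intro nn_integral_multc[symmetric]) measurable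
  also have "\<dots> = (\<integral>\<^sup>+\<omega>\<in>A. ennreal (exp_martingale k x s \<omega>) \<partial>M)"
  proof (intro nn_integral_cong)
    fix \<omega>
    have "k * Y x s \<omega> - k\<^sup>2 * noise_var 0 t / 2 + k\<^sup>2 * noise_var s t / 2 = k * Y x s \<omega> - k\<^sup>2 * noise_var 0 s / 2"
      unfolding noise_var_add[of 0 s t, symmetric] by (simp add: distrib_left add_divide_distrib)
    then have "Z \<omega> * exp (k\<^sup>2 * noise_var s t / 2) = indicator A \<omega> * exp_martingale k x s \<omega>"
      unfolding Z_def exp_martingale_def by (metis exp_add mult.assoc)
    moreover have "ennreal (Z \<omega>) * ennreal (exp (k\<^sup>2 * noise_var s t / 2)) = ennreal (Z \<omega> * exp (k\<^sup>2 * noise_var s t / 2))"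
      by (rule ennreal_mult'[symmetric]) (simp add: Z_def)
    ultimately show "ennreal (Z \<omega>) * ennreal (exp (k\<^sup>2 * noise_var s t / 2)) = ennreal (exp_martingale k x s \<omega>) * indicator A \<omega>"
      by (simp add: indicator_def)
  qed
  finally show ?thesis .
qed

lemma nn_integral_exp_martingale:
  assumes "0 \<le> t"
  shows "(\<integral>\<^sup>+\<omega>. ennreal (exp_martingale k x t \<omega>) \<partial>M) = ennreal (exp (k * (x - \<theta>)))"
proof -
  have "(\<integral>\<^sup>+\<omega>\<in>space M. ennreal (exp_martingale k x t \<omega>) \<partial>M) = (\<integral>\<^sup>+\<omega>\<in>space M. ennreal (exp_martingale k x 0 \<omega>) \<partial>M)"
    using sets.top[of "\<F> 0"] assms by (intro exp_martingale_martingale) auto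
  also have "\<dots> = (\<integral>\<^sup>+\<omega>. ennreal (exp (k * (x - \<theta>))) \<partial>M)"
    by (intro nn_integral_cong) (simp add: exp_martingale_def Y_0 noise_var_def)
  finally show ?thesis
    by (simp add: emeasure_space_1 cong: nn_integral_cong)
qed

end

section \<open>Optional stopping\<close>

text \<open>For s \<ge> 0 this is the least multiple of 1/(n+1) not below s. Rounding up, not down,
  keeps a stopping time a stopping time.\<close>

definition round_up :: "nat \<Rightarrow> real \<Rightarrow> real" where
  "round_up n s = real (nat \<lceil>real (Suc n) * s\<rceil>) / real (Suc n)"

lemma round_up_bounds:
  assumes "s \<ge> 0"
  shows "s \<le> round_up n s" "round_up n s \<le> s + 1 / real (Suc n)"
proof -
  have "real (nat \<lceil>real (Suc n) * s\<rceil>) = of_int \<lceil>real (Suc n) * s\<rceil>"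
    using assms by (intro of_nat_nat) (simp add: order_less_le_trans[of "-1" 0] del: of_nat_Suc)
  then have d: "round_up n s = of_int \<lceil>real (Suc n) * s\<rceil> / real (Suc n)"
    by (simp only: round_up_def)
  have "real (Suc n) * s \<le> of_int \<lceil>real (Suc n) * s\<rceil>"
    by (rule le_of_int_ceiling)
  then show "s \<le> round_up n s"
    unfolding d by (simp add: pos_le_divide_eq mult.commute del: of_nat_Suc)
  have "of_int \<lceil>real (Suc n) * s\<rceil> \<le> real (Suc n) * s + 1"
    by (rule of_int_ceiling_le_add_one)
  also have "\<dots> = (s + 1 / real (Suc n)) * real (Suc n)"
    by (simp add: field_simps del: of_nat_Suc)
  finally show "round_up n s \<le> s + 1 / real (Suc n)"
    unfolding d by (simp only: pos_divide_le_eq of_nat_0_less_iff zero_less_Suc)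
qed

lemma round_up_nonneg: "round_up n s \<ge> 0"
  by (simp add: round_up_def)

lemma round_up_LIMSEQ:
  assumes "s \<ge> 0"
  shows "(\<lambda>n. round_up n s) \<longlonglongrightarrow> s"
proof (rule tendsto_sandwich[OF _ _ tendsto_const])
  have "(\<lambda>n. s + 1 / real (Suc n)) \<longlonglongrightarrow> s + 0"
    by (intro tendsto_add tendsto_const LIMSEQ_Suc[OF lim_const_over_n])
  then show "(\<lambda>n. s + 1 / real (Suc n)) \<longlonglongrightarrow> s"
    by simp
qed (use round_up_bounds[OF assms] in \<open>auto simp del: of_nat_Suc\<close>)

lemma continuous_round_up_LIMSEQ:
  fixes g :: "real \<Rightarrow> real"
  assumes "continuous_on {0..} g" "s \<ge> 0"
  shows "(\<lambda>n. g (round_up n s)) \<longlonglongrightarrow> g s"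
  using assms by (intro continuous_on_tendsto_compose[OF assms(1) round_up_LIMSEQ]) (auto simp: round_up_nonneg)

text \<open>Rounded times take countably many values, for which measurability is immediate; path
  continuity passes it to the limit.\<close>

lemma measurable_stopped_path:
  fixes f :: "real \<Rightarrow> 'a \<Rightarrow> real"
  assumes S [measurable]: "S \<in> borel_measurable M" and nonneg: "\<And>\<omega>. \<omega> \<in> space M \<Longrightarrow> 0 \<le> S \<omega>"
    and f: "\<And>t. t \<ge> 0 \<Longrightarrow> f t \<in> borel_measurable M"
    and cont: "\<And>\<omega>. \<omega> \<in> space M \<Longrightarrow> continuous_on {0..} (\<lambda>t. f t \<omega>)"
  shows "(\<lambda>\<omega>. f (S \<omega>) \<omega>) \<in> borel_measurable M"
proof (rule borel_measurable_LIMSEQ_real)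
  fix n
  have "(\<lambda>\<omega>. f (real (nat \<lceil>real (Suc n) * S \<omega>\<rceil>) / real (Suc n)) \<omega>) \<in> borel_measurable M"
    by (rule measurable_compose_countable[where f = "\<lambda>k. f (real k / real (Suc n))"])
       (auto intro!: f simp del: of_nat_Suc)
  then show "(\<lambda>\<omega>. f (round_up n (S \<omega>)) \<omega>) \<in> borel_measurable M"
    by (simp only: round_up_def)
qed (auto intro!: continuous_round_up_LIMSEQ cont nonneg)

section \<open>Scaling and monotonicity of the fundamental solution\<close>

lemma hermite_fun_nn_integral:
  assumes "\<rho> > 0"
  shows "ennreal (hermite_fun \<rho> y) = (\<integral>\<^sup>+u. ennreal (indicator {0<..} u * hermite_integrand \<rho> y u) \<partial>lborel)"
  using set_integrable_hermite[OF assms, of y]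
  unfolding hermite_fun_def set_lebesgue_integral_def set_integrable_def
  by (subst nn_integral_eq_integral) (auto simp: hermite_integrand_def)

lemma hermite_fun_scaled:
  assumes "\<rho> > 0" "a > 0"
  shows "ennreal (hermite_fun \<rho> y) = ennreal (a powr \<rho>) *
    (\<integral>\<^sup>+w. ennreal (indicator {0<..} w * w powr (\<rho> - 1) * exp (y * (a * w) - (a * w)\<^sup>2 / 2)) \<partial>lborel)"
proof -
  have "ennreal (hermite_fun \<rho> y) =
    ennreal \<bar>a\<bar> * (\<integral>\<^sup>+w. ennreal (indicator {0<..} (0 + a * w) * hermite_integrand \<rho> y (0 + a * w)) \<partial>lborel)"
    unfolding hermite_fun_nn_integral[OF assms(1)]
    by (rule nn_integral_real_affine) (use assms in auto)
  also have "\<dots> = ennreal a * (\<integral>\<^sup>+w. ennreal (a powr (\<rho> - 1)) *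
     ennreal (indicator {0<..} w * w powr (\<rho> - 1) * exp (y * (a * w) - (a * w)\<^sup>2 / 2)) \<partial>lborel)"
    using assms
    by (intro arg_cong2[where f = "(*)"] nn_integral_cong)
       (auto simp: hermite_integrand_def indicator_def powr_mult zero_less_mult_iff mult.assoc simp flip: ennreal_mult')
  also have "\<dots> = ennreal a * (ennreal (a powr (\<rho> - 1)) * (\<integral>\<^sup>+w.
     ennreal (indicator {0<..} w * w powr (\<rho> - 1) * exp (y * (a * w) - (a * w)\<^sup>2 / 2)) \<partial>lborel))"
    by (subst nn_integral_cmult) auto
  also have "\<dots> = ennreal (a * a powr (\<rho> - 1)) * (\<integral>\<^sup>+w.
     ennreal (indicator {0<..} w * w powr (\<rho> - 1) * exp (y * (a * w) - (a * w)\<^sup>2 / 2)) \<partial>lborel)"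
    using assms by (simp add: ennreal_mult' mult.assoc)
  also have "a * a powr (\<rho> - 1) = a powr \<rho>"
    using assms by (simp add: powr_mult_base)
  finally show ?thesis .
qed

lemma hermite_fun_mono:
  assumes "\<rho> > 0" "y \<le> z"
  shows "hermite_fun \<rho> y \<le> hermite_fun \<rho> z"
proof (rule DERIV_nonneg_imp_nondecreasing[OF assms(2)])
  show "\<exists>d. (hermite_fun \<rho> has_field_derivative d) (at x) \<and> 0 \<le> d" for x
    using hermite_fun_has_field_derivative[OF assms(1), of x] hermite_fun_pos[of "\<rho> + 1" x] assms(1)
    by (intro exI[of _ "hermite_fun (\<rho> + 1) x"]) auto
qed

context ou_process
begin

lemma exp_martingale_continuous: "\<omega> \<in> space M \<Longrightarrow> continuous_on {0..} (\<lambda>t. exp_martingale k x t \<omega>)"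
  unfolding exp_martingale_def noise_var_def using mu_pos by (intro continuous_intros Y_continuous) auto

text \<open>For rounded times the martingale property is applied on each event of a fixed value,
  replacing that value by the horizon N. Removing the rounding needs bounded second moments, which
  come from the rounded identity at parameter 2 k.\<close>

lemma exp_martingale_optional_stopping:
  fixes S :: "'a \<Rightarrow> real" and N :: nat
  assumes S [measurable]: "S \<in> borel_measurable M"
    and bd: "\<And>\<omega>. \<omega> \<in> space M \<Longrightarrow> 0 \<le> S \<omega> \<and> S \<omega> \<le> real N"
    and stop: "\<And>t. t \<ge> 0 \<Longrightarrow> {\<omega> \<in> space M. S \<omega> \<le> t} \<in> sets (\<F> t)"
  shows "(\<integral>\<^sup>+\<omega>. ennreal (exp_martingale k x (S \<omega>) \<omega>) \<partial>M) = ennreal (exp (k * (x - \<theta>)))"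
proof -
  have exp_martingale_M: "exp_martingale k x t \<in> borel_measurable M" if "t \<ge> 0" for k t
    using filtration_measurable[OF exp_martingale_measurable[OF that]] .
  \<comment> \<open>N is an integer, hence a multiple of 1/(n+1) for every n, so rounding never
    passes it.\<close>
  have round_up_le: "round_up n (S \<omega>) \<le> real N" if "\<omega> \<in> space M" for n \<omega>
  proof -
    have "real (Suc n) * S \<omega> \<le> real (Suc n * N)"
      using bd[OF that] unfolding of_nat_mult by (intro mult_left_mono) auto
    then have "nat \<lceil>real (Suc n) * S \<omega>\<rceil> \<le> Suc n * N"
      by (simp only: ceiling_le_iff nat_le_iff of_int_of_nat_eq)
    then have "real (nat \<lceil>real (Suc n) * S \<omega>\<rceil>) \<le> real N * real (Suc n)"
      by (metis of_nat_le_iff of_nat_mult mult.commute)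
    then show ?thesis
      unfolding round_up_def by (simp only: pos_divide_le_eq of_nat_0_less_iff zero_less_Suc)
  qed
  \<comment> \<open>Stated for every k, as it is also needed at 2 k.\<close>
  have round_up_eq: "(\<integral>\<^sup>+\<omega>. ennreal (exp_martingale k x (round_up n (S \<omega>)) \<omega>) \<partial>M) = ennreal (exp (k * (x - \<theta>)))" for n k
  proof -
    define q where "q = (\<lambda>\<omega>. nat \<lceil>real (Suc n) * S \<omega>\<rceil>)"
    define A where "A = (\<lambda>j. {\<omega> \<in> space M. q \<omega> = j})"
    define m where "m = Suc n * N"
    have q_le: "q \<omega> \<le> j \<longleftrightarrow> S \<omega> \<le> real j / real (Suc n)" for \<omega> j
      by (simp add: q_def nat_le_iff ceiling_le_iff pos_le_divide_eq mult.commute del: of_nat_Suc)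
    have A_le: "{\<omega> \<in> space M. q \<omega> \<le> i} \<in> sets (\<F> (real j / real (Suc n)))" if "i \<le> j" for i j
    proof -
      have "{\<omega> \<in> space M. q \<omega> \<le> i} \<in> sets (\<F> (real i / real (Suc n)))"
        unfolding q_le by (rule stop) simp
      moreover have "ennreal (real i / real (Suc n)) \<le> ennreal (real j / real (Suc n))"
        using that by (intro ennreal_leI divide_right_mono) auto
      ultimately show ?thesis
        using sets_nat_filtration_mono by blast
    qed
    have A: "A j \<in> sets (\<F> (real j / real (Suc n)))" for j
    proof (cases j)
      case 0
      then show ?thesis
        using A_le[of 0 j] by (simp add: A_def)
    next
      case (Suc i)
      then have "A j = {\<omega> \<in> space M. q \<omega> \<le> j} - {\<omega> \<in> space M. q \<omega> \<le> i}"
        by (auto simp: A_def)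
      then show ?thesis
        using A_le[of i j] A_le[of j j] Suc by auto
    qed
    have A_M: "A j \<in> sets M" for j
      using A sets_filtration_subset by blast
    have q_m: "q \<omega> \<le> m" if "\<omega> \<in> space M" for \<omega>
      using bd[OF that] by (simp add: q_le m_def del: of_nat_Suc mult_Suc)
    have split: "(\<Sum>j\<le>m. h j * indicator (A j) \<omega>) = h (q \<omega>)" if "\<omega> \<in> space M"
      for h :: "nat \<Rightarrow> ennreal" and \<omega>
    proof -
      have "(\<Sum>j\<le>m. h j * indicator (A j) \<omega>) = (\<Sum>j\<in>{q \<omega>}. h j * indicator (A j) \<omega>)"
        using q_m[OF that] by (intro sum.mono_neutral_right) (auto simp: A_def)
      then show ?thesis
        using that by (simp add: A_def)
    qed
    have "(\<integral>\<^sup>+\<omega>. ennreal (exp_martingale k x (round_up n (S \<omega>)) \<omega>) \<partial>M)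
      = (\<integral>\<^sup>+\<omega>. (\<Sum>j\<le>m. ennreal (exp_martingale k x (real j / real (Suc n)) \<omega>) * indicator (A j) \<omega>) \<partial>M)"
    proof (rule nn_integral_cong)
      fix \<omega> assume "\<omega> \<in> space M"
      from split[OF this, of "\<lambda>j. ennreal (exp_martingale k x (real j / real (Suc n)) \<omega>)"]
      show "ennreal (exp_martingale k x (round_up n (S \<omega>)) \<omega>) =
        (\<Sum>j\<le>m. ennreal (exp_martingale k x (real j / real (Suc n)) \<omega>) * indicator (A j) \<omega>)"
        by (simp only: round_up_def q_def)
    qed
    also have "\<dots> = (\<Sum>j\<le>m. \<integral>\<^sup>+\<omega>\<in>A j. ennreal (exp_martingale k x (real j / real (Suc n)) \<omega>) \<partial>M)"
    proof (rule nn_integral_sum)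
      fix j
      have [measurable]: "exp_martingale k x (real j / real (Suc n)) \<in> borel_measurable M"
        by (rule exp_martingale_M) simp
      show "(\<lambda>\<omega>. ennreal (exp_martingale k x (real j / real (Suc n)) \<omega>) * indicator (A j) \<omega>) \<in> borel_measurable M"
        using A_M[of j] by measurable
    qed
    also have "\<dots> = (\<Sum>j\<le>m. \<integral>\<^sup>+\<omega>\<in>A j. ennreal (exp_martingale k x (real N) \<omega>) \<partial>M)"
    proof (intro sum.cong refl, rule exp_martingale_martingale[symmetric, OF A])
      fix j assume "j \<in> {..m}"
      then have "real j \<le> real N * real (Suc n)"
        unfolding m_def by (metis atMost_iff mult.commute of_nat_le_iff of_nat_mult)
      then show "real j / real (Suc n) \<le> real N"
        by (simp only: pos_divide_le_eq of_nat_0_less_iff zero_less_Suc)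
    qed simp
    also have "\<dots> = (\<integral>\<^sup>+\<omega>. (\<Sum>j\<le>m. ennreal (exp_martingale k x (real N) \<omega>) * indicator (A j) \<omega>) \<partial>M)"
    proof (rule nn_integral_sum[symmetric])
      fix j
      have [measurable]: "exp_martingale k x (real N) \<in> borel_measurable M"
        by (rule exp_martingale_M) simp
      show "(\<lambda>\<omega>. ennreal (exp_martingale k x (real N) \<omega>) * indicator (A j) \<omega>) \<in> borel_measurable M"
        using A_M[of j] by measurable
    qed
    also have "\<dots> = (\<integral>\<^sup>+\<omega>. ennreal (exp_martingale k x (real N) \<omega>) \<partial>M)"
      by (intro nn_integral_cong split)
    also have "\<dots> = ennreal (exp (k * (x - \<theta>)))"
      by (rule nn_integral_exp_martingale) simp
    finally show ?thesis .
  qed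
  show ?thesis
  proof (rule nn_integral_LIMSEQ_L2_bounded[where Z = "\<lambda>n \<omega>. exp_martingale k x (round_up n (S \<omega>)) \<omega>"
        and C = "exp (k\<^sup>2 * noise_var 0 (real N)) * exp (2 * k * (x - \<theta>))"])
    show "(\<lambda>\<omega>. exp_martingale k x (round_up n (S \<omega>)) \<omega>) \<in> borel_measurable M" for n
      by (rule measurable_stopped_path) (auto simp: round_up_nonneg round_up_def[abs_def] exp_martingale_M exp_martingale_continuous)
    show "(\<lambda>n. exp_martingale k x (round_up n (S \<omega>)) \<omega>) \<longlonglongrightarrow> exp_martingale k x (S \<omega>) \<omega>" if "\<omega> \<in> space M" for \<omega>
      using continuous_round_up_LIMSEQ[OF exp_martingale_continuous[OF that]] bd[OF that] by simp
    show "(\<lambda>n. \<integral>\<^sup>+\<omega>. ennreal (exp_martingale k x (round_up n (S \<omega>)) \<omega>) \<partial>M) \<longlonglongrightarrow> ennreal (exp (k * (x - \<theta>)))"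
      by (simp add: round_up_eq)
    fix n
    have [measurable]: "(\<lambda>\<omega>. exp_martingale (2 * k) x (round_up n (S \<omega>)) \<omega>) \<in> borel_measurable M"
      by (rule measurable_stopped_path) (auto simp: round_up_nonneg round_up_def[abs_def] exp_martingale_M exp_martingale_continuous)
    have "(\<integral>\<^sup>+\<omega>. ennreal ((exp_martingale k x (round_up n (S \<omega>)) \<omega>)\<^sup>2) \<partial>M)
      \<le> (\<integral>\<^sup>+\<omega>. ennreal (exp (k\<^sup>2 * noise_var 0 (real N))) * ennreal (exp_martingale (2 * k) x (round_up n (S \<omega>)) \<omega>) \<partial>M)"
    proof (rule nn_integral_mono)
      fix \<omega> assume \<omega>: "\<omega> \<in> space M"
      let ?t = "round_up n (S \<omega>)"
      \<comment> \<open>With v the variance up to this time, the exponents 2 k Y - k^2 v and 2 k Y -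
        2 k^2 v differ by k^2 v, which is bounded up to the horizon.\<close>
      have "(exp_martingale k x ?t \<omega>)\<^sup>2 = exp (k\<^sup>2 * noise_var 0 ?t) * exp_martingale (2 * k) x ?t \<omega>"
        unfolding exp_martingale_def exp_double[symmetric] exp_add[symmetric] by (simp add: algebra_simps power_mult_distrib)
      also have "\<dots> \<le> exp (k\<^sup>2 * noise_var 0 (real N)) * exp_martingale (2 * k) x ?t \<omega>"
        using noise_var_mono[OF round_up_le[OF \<omega>], of 0 n] by (intro mult_right_mono) (auto simp: exp_martingale_def mult_left_mono)
      finally show "ennreal ((exp_martingale k x ?t \<omega>)\<^sup>2) \<le>
        ennreal (exp (k\<^sup>2 * noise_var 0 (real N))) * ennreal (exp_martingale (2 * k) x ?t \<omega>)"
        by (simp add: ennreal_leI flip: ennreal_mult')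
    qed
    also have "\<dots> = ennreal (exp (k\<^sup>2 * noise_var 0 (real N))) * ennreal (exp (2 * k * (x - \<theta>)))"
      by (subst nn_integral_cmult) (auto simp: round_up_eq)
    finally show "(\<integral>\<^sup>+\<omega>. ennreal ((exp_martingale k x (round_up n (S \<omega>)) \<omega>)\<^sup>2) \<partial>M)
      \<le> ennreal (exp (k\<^sup>2 * noise_var 0 (real N)) * exp (2 * k * (x - \<theta>)))"
      by (simp add: ennreal_mult)
  qed (auto simp: exp_martingale_def)
qed

end

section \<open>The liquidation problem\<close>

text \<open>The infimum cannot be t without a visit by time t: a path below b on [0, t] stays below
  b for a while longer by continuity, which pushes the infimum strictly past t.\<close>

lemma hitting_time_le_iff:
  fixes g :: "real \<Rightarrow> real"
  assumes cont: "continuous_on {0..} g" and t: "t \<ge> 0"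
  shows "Inf {ennreal s | s. s \<ge> 0 \<and> g s \<ge> b} \<le> ennreal t \<longleftrightarrow> (\<exists>s\<in>{0..t}. g s \<ge> b)"
proof
  assume "\<exists>s\<in>{0..t}. g s \<ge> b"
  then obtain s where s: "0 \<le> s" "s \<le> t" "g s \<ge> b"
    by auto
  then have "Inf {ennreal s | s. s \<ge> 0 \<and> g s \<ge> b} \<le> ennreal s"
    by (intro Inf_lower) auto
  also have "\<dots> \<le> ennreal t"
    using s by (intro ennreal_leI)
  finally show "Inf {ennreal s | s. s \<ge> 0 \<and> g s \<ge> b} \<le> ennreal t" .
next
  assume le: "Inf {ennreal s | s. s \<ge> 0 \<and> g s \<ge> b} \<le> ennreal t"
  show "\<exists>s\<in>{0..t}. g s \<ge> b"
  proof (rule ccontr)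
    assume "\<not> ?thesis"
    then have below: "g s < b" if "0 \<le> s" "s \<le> t" for s
      using that by force
    have "(g \<longlongrightarrow> g t) (at t within {0..})"
      using cont t by (simp add: continuous_on_def)
    then have "\<forall>\<^sub>F s in at t within {0..}. g s < b"
      using below[of t] t by (intro order_tendstoD(2)) auto
    then obtain d where d: "d > 0" "\<And>s. s \<ge> 0 \<Longrightarrow> s \<noteq> t \<Longrightarrow> dist s t < d \<Longrightarrow> g s < b"
      by (auto simp: eventually_at)
    have "ennreal (t + d) \<le> Inf {ennreal s | s. s \<ge> 0 \<and> g s \<ge> b}"
    proof (rule Inf_greatest)
      fix y assume "y \<in> {ennreal s | s. s \<ge> 0 \<and> g s \<ge> b}"
      then obtain s where s: "y = ennreal s" "s \<ge> 0" "g s \<ge> b"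
        by auto
      have "s \<ge> t + d"
      proof (rule ccontr)
        assume "\<not> s \<ge> t + d"
        then show False
          using below[of s] d(2)[of s] s by (cases "s \<le> t") (auto simp: dist_real_def)
      qed
      then show "ennreal (t + d) \<le> y"
        using s by (simp add: ennreal_leI)
    qed
    with le have "ennreal (t + d) \<le> ennreal t"
      by (rule order_trans[rotated])
    then show False
      using d(1) t by (simp add: ennreal_le_iff)
  qed
qed

text \<open>Starting at or below b, the intermediate value theorem finds a time with value exactly b
  no later than any visit to the upper set; minimality identifies it with t.\<close>

lemma hitting_time_attained:
  fixes g :: "real \<Rightarrow> real"
  assumes cont: "continuous_on {0..} g" and g0: "g 0 \<le> b" and t: "t \<ge> 0"
    and eq: "Inf {ennreal s | s. s \<ge> 0 \<and> g s \<ge> b} = ennreal t"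
  shows "g t = b"
proof -
  obtain s where s: "s \<in> {0..t}" "g s \<ge> b"
    using hitting_time_le_iff[OF cont t, of b] eq by auto
  have "\<exists>u\<ge>0. u \<le> s \<and> g u = b"
    using IVT'[of g 0 b s] s g0 continuous_on_subset[OF cont, of "{0..s}"] by auto
  then obtain u where u: "0 \<le> u" "u \<le> s" "g u = b"
    by blast
  then have "Inf {ennreal s | s. s \<ge> 0 \<and> g s \<ge> b} \<le> ennreal u"
    by (intro Inf_lower) auto
  then have "t \<le> u"
    using eq u t by (simp add: ennreal_le_iff)
  then have "u = t"
    using u s by simp
  with u show ?thesis
    by simp
qed

text \<open>Rational times may miss the visit itself, so the level is lowered by 1/(n+1); conversely
  the maximum over the compact interval reaches b. The minimum with t keeps all sampled times within
  the information at t.\<close>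

lemma exceeds_level_iff_countable:
  fixes g :: "real \<Rightarrow> real"
  assumes cont: "continuous_on {0..} g" and t: "t \<ge> 0"
  shows "(\<exists>s\<in>{0..t}. g s \<ge> b) \<longleftrightarrow>
    (\<forall>n. \<exists>m k. g (min t (real k / real (Suc m))) > b - 1 / real (Suc n))"
proof
  assume "\<exists>s\<in>{0..t}. g s \<ge> b"
  then obtain s where s: "0 \<le> s" "s \<le> t" "g s \<ge> b"
    by auto
  have "(\<lambda>m. min t (round_up m s)) \<longlonglongrightarrow> min t s"
    by (intro tendsto_min tendsto_const round_up_LIMSEQ s)
  then have "(\<lambda>m. g (min t (round_up m s))) \<longlonglongrightarrow> g (min t s)"
    using s t by (intro continuous_on_tendsto_compose[OF cont]) (auto simp: round_up_nonneg)
  then have lim: "(\<lambda>m. g (min t (round_up m s))) \<longlonglongrightarrow> g s"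
    using s by (simp only: min_absorb2)
  show "\<forall>n. \<exists>m k. g (min t (real k / real (Suc m))) > b - 1 / real (Suc n)"
  proof
    fix n
    have "b - 1 / real (Suc n) < g s"
    proof -
      have "0 < 1 / real (Suc n)"
        by simp
      then show ?thesis
        using s(3) by linarith
    qed
    then have "\<forall>\<^sub>F m in sequentially. b - 1 / real (Suc n) < g (min t (round_up m s))"
      by (rule order_tendstoD(1)[OF lim])
    then obtain m where "b - 1 / real (Suc n) < g (min t (round_up m s))"
      by (meson eventually_sequentially order_refl)
    then show "\<exists>m k. g (min t (real k / real (Suc m))) > b - 1 / real (Suc n)"
      unfolding round_up_def by blast
  qed
next
  assume *: "\<forall>n. \<exists>m k. g (min t (real k / real (Suc m))) > b - 1 / real (Suc n)"
  obtain s where s: "s \<in> {0..t}" "\<And>u. u \<in> {0..t} \<Longrightarrow> g u \<le> g s"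
    using continuous_attains_sup[of "{0..t}" g] continuous_on_subset[OF cont, of "{0..t}"] t by auto
  have "b - 1 / real (Suc n) \<le> g s" for n
  proof -
    obtain m k where "g (min t (real k / real (Suc m))) > b - 1 / real (Suc n)"
      using * by blast
    moreover have "g (min t (real k / real (Suc m))) \<le> g s"
      using t by (intro s(2)) simp
    ultimately show ?thesis
      by simp
  qed
  moreover have "(\<lambda>n. b - 1 / real (Suc n)) \<longlonglongrightarrow> b - 0"
    by (intro tendsto_diff tendsto_const LIMSEQ_Suc[OF lim_const_over_n])
  ultimately have "b \<le> g s"
    by (intro LIMSEQ_le_const2[of _ b]) auto
  then show "\<exists>s\<in>{0..t}. g s \<ge> b"
    using s(1) by blast
qed

context ou_process
begin

text \<open>The filtration is the raw one, so the event must be decided by the path up to t exactly;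
  closedness of the target set and continuity allow this.\<close>

lemma hitting_time_stopping_time:
  "stopping_time (nat_filtration M B) (\<lambda>\<omega>. Inf {ennreal t | t. t \<ge> 0 \<and> X x t \<omega> \<ge> b})"
proof (rule stopping_timeI)
  fix u :: ennreal
  show "Measurable.pred (nat_filtration M B u) (\<lambda>\<omega>. Inf {ennreal t | t. t \<ge> 0 \<and> X x t \<omega> \<ge> b} \<le> u)"
  proof (cases u)
    case (real t)
    have X: "X x (min t (real k / real (Suc m))) \<in> borel_measurable (\<F> t)" for m k
      by (rule measurable_nat_filtration_mono[OF _ X_measurable]) (use real in \<open>auto intro!: ennreal_leI\<close>)
    have "Measurable.pred (\<F> t) (\<lambda>\<omega>. \<forall>n. \<exists>m k. X x (min t (real k / real (Suc m))) \<omega> > b - 1 / real (Suc n))"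
      using X by measurable
    then show ?thesis
      unfolding real(2)
      by (rule measurable_cong[THEN iffD1, rotated])
         (use hitting_time_le_iff[OF X_continuous] exceeds_level_iff_countable[OF X_continuous] real in auto)
  next
    case top
    then show ?thesis
      by simp
  qed
qed

end

section \<open>Discounted solutions as mixtures of martingales\<close>

locale ou_stopping = ou_process M B \<mu> \<theta> \<sigma> X
  for M :: "'a measure" and B :: "real \<Rightarrow> 'a \<Rightarrow> real" and \<mu> \<theta> \<sigma> :: real
    and X :: "real \<Rightarrow> real \<Rightarrow> 'a \<Rightarrow> real" +
  fixes r c :: real
  assumes r_pos: "r > 0" and c_pos: "c > 0"
begin

definition \<alpha> :: real where "\<alpha> = sqrt (2 * \<mu> / \<sigma>\<^sup>2)"

definition \<rho> :: real where "\<rho> = r / \<mu>"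

lemma alpha_pos: "\<alpha> > 0"
  using mu_pos sigma_pos by (simp add: \<alpha>_def)

lemma alpha_sigma: "\<alpha>\<^sup>2 * \<sigma>\<^sup>2 = 2 * \<mu>"
  using mu_pos sigma_pos by (simp add: \<alpha>_def)

lemma rho_gt_0: "\<rho> > 0"
  using mu_pos r_pos by (simp add: \<rho>_def)

sublocale liquidation_threshold \<rho> "1 / \<alpha>" \<theta> c
  by unfold_locales (use rho_gt_0 alpha_pos c_pos in auto)

lemma F_OU_eq: "F_OU \<mu> \<theta> \<sigma> r x = hermite_fun \<rho> (\<alpha> * (x - \<theta>))"
  unfolding F_OU_def hermite_fun_def hermite_integrand_def \<alpha>_def \<rho>_def ..

lemma deriv_F_OU: "deriv (F_OU \<mu> \<theta> \<sigma> r) x = \<alpha> * hermite_fun (\<rho> + 1) (\<alpha> * (x - \<theta>))"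
proof (rule DERIV_imp_deriv)
  have "((\<lambda>x. \<alpha> * (x - \<theta>)) has_field_derivative \<alpha>) (at x)"
    by (auto intro!: derivative_eq_intros)
  from f_deriv(1)[OF this]
  show "(F_OU \<mu> \<theta> \<sigma> r has_field_derivative \<alpha> * hermite_fun (\<rho> + 1) (\<alpha> * (x - \<theta>))) (at x)"
    unfolding F_OU_eq[abs_def] by (simp add: mult.commute)
qed

lemma gain_eq: "gain (\<alpha> * (x - \<theta>)) = exp x - c"
  using alpha_pos by (simp add: gain_def)

lemma smooth_fit_iff:
  "exp x * F_OU \<mu> \<theta> \<sigma> r x = (exp x - c) * deriv (F_OU \<mu> \<theta> \<sigma> r) x \<longleftrightarrow> gain_wronskian (\<alpha> * (x - \<theta>)) = 0"
proof -
  let ?y = "\<alpha> * (x - \<theta>)"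
  have "gain_wronskian ?y = exp (- (?y\<^sup>2 / 2)) / \<alpha> * (exp x * f0 ?y - (exp x - c) * (\<alpha> * f1 ?y))"
    using alpha_pos unfolding gain_wronskian_def gain_eq by (simp add: right_diff_distrib)
  then show ?thesis
    using alpha_pos unfolding F_OU_eq deriv_F_OU by simp
qed

definition mixing_density :: "real \<Rightarrow> real" where
  "mixing_density w = indicator {0<..} w * w powr (\<rho> - 1) * exp (- (w\<^sup>2 / 2))"

lemma mixing_density_nonneg: "mixing_density w \<ge> 0"
  by (simp add: mixing_density_def)

lemma mixing_density_measurable [measurable]: "mixing_density \<in> borel_measurable borel"
  unfolding mixing_density_def[abs_def] by measurable

text \<open>The sign e is 1 or -1 and selects the fundamental solution or its reflection.\<close>

definition discounted_solution :: "real \<Rightarrow> real \<Rightarrow> real \<Rightarrow> 'a \<Rightarrow> real" where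
  "discounted_solution e x t \<omega> = exp (- r * t) * hermite_fun \<rho> (e * \<alpha> * (X x t \<omega> - \<theta>))"

lemma discounted_nonneg: "discounted_solution e x t \<omega> \<ge> 0"
  using f_pos(1) by (simp add: discounted_solution_def less_imp_le)

text \<open>Substitute u = w exp(mu t) in the integral that defines the fundamental solution.\<close>

lemma discounted_eq_mixture:
  assumes e: "e\<^sup>2 = 1"
  shows "ennreal (discounted_solution e x t \<omega>)
    = (\<integral>\<^sup>+w. ennreal (mixing_density w) * ennreal (exp_martingale (e * \<alpha> * w) x t \<omega>) \<partial>lborel)"
proof -
  define a where "a = exp (\<mu> * t)"
  define y where "y = e * \<alpha> * (X x t \<omega> - \<theta>)"
  have a: "a > 0" "a powr \<rho> = exp (r * t)"
    using mu_pos by (auto simp: a_def \<rho>_def powr_def)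
  \<comment> \<open>The choice of \<alpha> enters here: \<alpha>^2 \<sigma>^2 = 2 \<mu> makes
    \<alpha>^2 times the variance equal to a^2 - 1, so (a w)^2 is w^2 plus the martingale
    correction.\<close>
  have exponent: "y * (a * w) - (a * w)\<^sup>2 / 2 = - (w\<^sup>2 / 2) + (e * \<alpha> * w * Y x t \<omega> - (e * \<alpha> * w)\<^sup>2 * noise_var 0 t / 2)" for w
  proof -
    have "exp (2 * \<mu> * t) = a\<^sup>2"
      by (simp add: a_def exp_double[symmetric] mult.assoc)
    then have v: "\<sigma>\<^sup>2 * (a\<^sup>2 - 1) = 2 * \<mu> * noise_var 0 t"
      using mu_pos by (simp add: noise_var_def field_simps)
    have "\<mu> * (2 * (\<alpha>\<^sup>2 * noise_var 0 t)) = \<mu> * (2 * (a\<^sup>2 - 1))"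
      using v alpha_sigma by algebra
    then have "\<alpha>\<^sup>2 * noise_var 0 t = a\<^sup>2 - 1"
      using mu_pos by simp
    then have "(e * \<alpha> * w)\<^sup>2 * noise_var 0 t = w\<^sup>2 * (a\<^sup>2 - 1)"
      using e by algebra
    then show ?thesis
      by (simp add: y_def Y_def a_def[symmetric] power_mult_distrib algebra_simps)
  qed
  have "ennreal (discounted_solution e x t \<omega>) = ennreal (exp (- r * t)) * ennreal (hermite_fun \<rho> y)"
    by (simp add: discounted_solution_def y_def ennreal_mult')
  also have "\<dots> = (ennreal (exp (- r * t)) * ennreal (a powr \<rho>)) *
    (\<integral>\<^sup>+w. ennreal (indicator {0<..} w * w powr (\<rho> - 1) * exp (y * (a * w) - (a * w)\<^sup>2 / 2)) \<partial>lborel)"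
    unfolding hermite_fun_scaled[OF rho_pos a(1)] by (simp only: mult.assoc)
  also have "ennreal (exp (- r * t)) * ennreal (a powr \<rho>) = 1"
    by (simp add: a(2) exp_minus_inverse flip: ennreal_mult' exp_add)
  also have "1 * (\<integral>\<^sup>+w. ennreal (indicator {0<..} w * w powr (\<rho> - 1) * exp (y * (a * w) - (a * w)\<^sup>2 / 2)) \<partial>lborel)
    = (\<integral>\<^sup>+w. ennreal (mixing_density w) * ennreal (exp_martingale (e * \<alpha> * w) x t \<omega>) \<partial>lborel)"
    unfolding exponent exp_add mixing_density_def exp_martingale_def mult_1
    by (intro nn_integral_cong) (simp add: mult.assoc flip: ennreal_mult')
  finally show ?thesis .
qed

text \<open>Tonelli over the mixing parameter w reduces the claim to the exponential martingales;
  nonnegativity spares any integrability check.\<close>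

lemma discounted_optional_stopping:
  fixes S :: "'a \<Rightarrow> real" and N :: nat
  assumes e: "e\<^sup>2 = 1"
    and S [measurable]: "S \<in> borel_measurable M"
    and bd: "\<And>\<omega>. \<omega> \<in> space M \<Longrightarrow> 0 \<le> S \<omega> \<and> S \<omega> \<le> real N"
    and stop: "\<And>t. t \<ge> 0 \<Longrightarrow> {\<omega> \<in> space M. S \<omega> \<le> t} \<in> sets (\<F> t)"
  shows "(\<integral>\<^sup>+\<omega>. ennreal (discounted_solution e x (S \<omega>) \<omega>) \<partial>M) = ennreal (hermite_fun \<rho> (e * \<alpha> * (x - \<theta>)))"
proof -
  interpret pair_sigma_finite M lborel
    by (intro pair_sigma_finite.intro sigma_finite_measure_axioms sigma_finite_lborel)
  \<comment> \<open>The parameter w enters by an explicit formula, so this and measurability of S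
    give joint measurability in w and \<omega>.\<close>
  have [measurable]: "(\<lambda>\<omega>. Y x (S \<omega>) \<omega>) \<in> borel_measurable M"
    by (rule measurable_stopped_path)
       (auto intro: bd[THEN conjunct1] filtration_measurable[OF Y_measurable] Y_continuous)
  have "(\<integral>\<^sup>+\<omega>. ennreal (discounted_solution e x (S \<omega>) \<omega>) \<partial>M)
    = (\<integral>\<^sup>+\<omega>. (\<integral>\<^sup>+w. ennreal (mixing_density w) * ennreal (exp_martingale (e * \<alpha> * w) x (S \<omega>) \<omega>) \<partial>lborel) \<partial>M)"
    by (simp only: discounted_eq_mixture[OF e])
  also have "\<dots> = (\<integral>\<^sup>+w. (\<integral>\<^sup>+\<omega>. ennreal (mixing_density w) * ennreal (exp_martingale (e * \<alpha> * w) x (S \<omega>) \<omega>) \<partial>M) \<partial>lborel)"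
    by (rule Fubini'[symmetric]) (unfold exp_martingale_def noise_var_def, measurable)
  also have "\<dots> = (\<integral>\<^sup>+w. ennreal (mixing_density w) * (\<integral>\<^sup>+\<omega>. ennreal (exp_martingale (e * \<alpha> * w) x (S \<omega>) \<omega>) \<partial>M) \<partial>lborel)"
    by (intro nn_integral_cong nn_integral_cmult) (unfold exp_martingale_def noise_var_def, measurable)
  also have "\<dots> = (\<integral>\<^sup>+w. ennreal (mixing_density w) * ennreal (exp (e * \<alpha> * w * (x - \<theta>))) \<partial>lborel)"
    by (simp only: exp_martingale_optional_stopping[OF S bd stop])
  also have "\<dots> = (\<integral>\<^sup>+w. ennreal (indicator {0<..} w * hermite_integrand \<rho> (e * \<alpha> * (x - \<theta>)) w) \<partial>lborel)"
  proof (rule nn_integral_cong)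
    fix w
    have "exp (- (w\<^sup>2 / 2)) * exp (e * \<alpha> * w * (x - \<theta>)) = exp (e * \<alpha> * (x - \<theta>) * w - w\<^sup>2 / 2)"
      by (simp add: ac_simps flip: exp_add)
    then have "mixing_density w * exp (e * \<alpha> * w * (x - \<theta>)) = indicator {0<..} w * hermite_integrand \<rho> (e * \<alpha> * (x - \<theta>)) w"
      unfolding mixing_density_def hermite_integrand_def by (simp only: mult.assoc)
    then show "ennreal (mixing_density w) * ennreal (exp (e * \<alpha> * w * (x - \<theta>))) =
      ennreal (indicator {0<..} w * hermite_integrand \<rho> (e * \<alpha> * (x - \<theta>)) w)"
      by (simp add: mixing_density_nonneg flip: ennreal_mult')
  qed
  also have "\<dots> = ennreal (hermite_fun \<rho> (e * \<alpha> * (x - \<theta>)))"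
    by (rule hermite_fun_nn_integral[OF rho_pos, symmetric])
  finally show ?thesis .
qed

lemma discounted_truncated_stopping:
  assumes e: "e\<^sup>2 = 1" and \<tau>: "stopping_time (nat_filtration M B) \<tau>"
  shows "(\<integral>\<^sup>+\<omega>. ennreal (discounted_solution e x (enn2real (min (\<tau> \<omega>) (ennreal (real N)))) \<omega>) \<partial>M)
    = ennreal (hermite_fun \<rho> (e * \<alpha> * (x - \<theta>)))"
proof (rule discounted_optional_stopping[OF e])
  have [measurable]: "\<tau> \<in> borel_measurable M"
    by (rule measurable_stopping_time[OF \<tau> sets_filtration_subset space_nat_filtration])
  show "(\<lambda>\<omega>. enn2real (min (\<tau> \<omega>) (ennreal (real N)))) \<in> borel_measurable M"
    by measurable
  show "0 \<le> enn2real (min (\<tau> \<omega>) (ennreal (real N))) \<and> enn2real (min (\<tau> \<omega>) (ennreal (real N))) \<le> real N" for \<omega>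
    by (auto intro: enn2real_leI)
  fix t :: real assume t: "t \<ge> 0"
  show "{\<omega> \<in> space M. enn2real (min (\<tau> \<omega>) (ennreal (real N))) \<le> t} \<in> sets (\<F> t)"
  proof (cases "real N \<le> t")
    case True
    then have "{\<omega> \<in> space M. enn2real (min (\<tau> \<omega>) (ennreal (real N))) \<le> t} = space (\<F> t)"
      by (auto intro!: enn2real_leI min.coboundedI2 ennreal_leI)
    then show ?thesis
      by (simp only: sets.top)
  next
    case False
    have "enn2real (min a (ennreal (real N))) \<le> t \<longleftrightarrow> a \<le> ennreal t" for a
    proof -
      have "min a (ennreal (real N)) < top"
        by (simp add: min_less_iff_disj)
      then have "enn2real (min a (ennreal (real N))) \<le> t \<longleftrightarrow> min a (ennreal (real N)) \<le> ennreal t"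
        using t by (metis enn2real_leI ennreal_enn2real ennreal_leI)
      also have "\<dots> \<longleftrightarrow> a \<le> ennreal t"
        using False t by (auto simp: min_le_iff_disj)
      finally show ?thesis .
    qed
    then show ?thesis
      using stopping_timeD[OF \<tau>, of "ennreal t"] by (simp add: pred_def)
  qed
qed

text \<open>The value 0 at infinity matches the convention of the reward.\<close>

definition stopped_solution :: "real \<Rightarrow> real \<Rightarrow> ('a \<Rightarrow> ennreal) \<Rightarrow> 'a \<Rightarrow> real" where
  "stopped_solution e x \<tau> \<omega> = (if \<tau> \<omega> = \<infinity> then 0 else discounted_solution e x (enn2real (\<tau> \<omega>)) \<omega>)"

lemma discounted_measurable:
  assumes [measurable]: "S \<in> borel_measurable M" and S: "\<And>\<omega>. \<omega> \<in> space M \<Longrightarrow> 0 \<le> S \<omega>"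
  shows "(\<lambda>\<omega>. discounted_solution e x (S \<omega>) \<omega>) \<in> borel_measurable M"
proof -
  have [measurable]: "(\<lambda>\<omega>. X x (S \<omega>) \<omega>) \<in> borel_measurable M"
    by (rule measurable_stopped_path)
       (auto intro: S filtration_measurable[OF X_measurable] X_continuous)
  have "continuous_on UNIV (hermite_fun \<rho>)"
    using hermite_fun_has_field_derivative[OF rho_pos] by (intro DERIV_continuous_on) auto
  then have [measurable]: "hermite_fun \<rho> \<in> borel_measurable borel"
    by (rule borel_measurable_continuous_onI)
  show ?thesis
    unfolding discounted_solution_def by measurable
qed

lemma stopped_measurable:
  assumes \<tau>: "stopping_time (nat_filtration M B) \<tau>"
  shows "stopped_solution e x \<tau> \<in> borel_measurable M"
proof -
  have [measurable]: "\<tau> \<in> borel_measurable M"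
    by (rule measurable_stopping_time[OF \<tau> sets_filtration_subset space_nat_filtration])
  have [measurable]: "(\<lambda>\<omega>. discounted_solution e x (enn2real (\<tau> \<omega>)) \<omega>) \<in> borel_measurable M"
    by (rule discounted_measurable) auto
  show ?thesis
    unfolding stopped_solution_def[abs_def] by measurable
qed

text \<open>Fatou along the truncations at N, which are eventually constant where \<tau> is finite.
  Equality may fail, since the discounted solution need not fade when \<tau> exceeds N.\<close>

lemma nn_integral_stopped_le:
  assumes e: "e\<^sup>2 = 1" and \<tau>: "stopping_time (nat_filtration M B) \<tau>"
  shows "(\<integral>\<^sup>+\<omega>. ennreal (stopped_solution e x \<tau> \<omega>) \<partial>M) \<le> ennreal (hermite_fun \<rho> (e * \<alpha> * (x - \<theta>)))"
proof -
  have [measurable]: "\<tau> \<in> borel_measurable M"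
    by (rule measurable_stopping_time[OF \<tau> sets_filtration_subset space_nat_filtration])
  let ?S = "\<lambda>N \<omega>. discounted_solution e x (enn2real (min (\<tau> \<omega>) (ennreal (real N)))) \<omega>"
  have "(\<integral>\<^sup>+\<omega>. ennreal (stopped_solution e x \<tau> \<omega>) \<partial>M) \<le> (\<integral>\<^sup>+\<omega>. liminf (\<lambda>N. ennreal (?S N \<omega>)) \<partial>M)"
  proof (rule nn_integral_mono)
    fix \<omega>
    show "ennreal (stopped_solution e x \<tau> \<omega>) \<le> liminf (\<lambda>N. ennreal (?S N \<omega>))"
    proof (cases "\<tau> \<omega>")
      case (real t)
      have "\<forall>\<^sub>F N in sequentially. ennreal (stopped_solution e x \<tau> \<omega>) \<le> ennreal (?S N \<omega>)"
        using eventually_ge_at_top[of "nat \<lceil>t\<rceil>"]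
      proof eventually_elim
        case (elim N)
        then have "t \<le> real N"
          by linarith
        then have "min (\<tau> \<omega>) (ennreal (real N)) = \<tau> \<omega>"
          using real by (simp add: min_absorb1 ennreal_leI)
        then show ?case
          using real by (simp add: stopped_solution_def)
      qed
      then show ?thesis
        by (rule Liminf_bounded)
    next
      case top
      then show ?thesis
        by (simp add: stopped_solution_def)
    qed
  qed
  also have "\<dots> \<le> liminf (\<lambda>N. \<integral>\<^sup>+\<omega>. ennreal (?S N \<omega>) \<partial>M)"
  proof (rule nn_integral_liminf)
    fix N
    have [measurable]: "?S N \<in> borel_measurable M"
      by (rule discounted_measurable) auto
    show "(\<lambda>\<omega>. ennreal (?S N \<omega>)) \<in> borel_measurable M"
      by measurable
  qed
  also have "\<dots> = ennreal (hermite_fun \<rho> (e * \<alpha> * (x - \<theta>)))"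
    by (simp add: discounted_truncated_stopping[OF e \<tau>] Liminf_const)
  finally show ?thesis .
qed

text \<open>If the path stays at or below b before \<tau>, monotonicity bounds the part with \<tau>
  > N by exp(-r N) times the value at b, which vanishes as N grows.\<close>

lemma nn_integral_stopped_ge:
  assumes \<tau>: "stopping_time (nat_filtration M B) \<tau>"
    and below: "\<And>\<omega> t. \<omega> \<in> space M \<Longrightarrow> t \<ge> 0 \<Longrightarrow> ennreal t < \<tau> \<omega> \<Longrightarrow> X x t \<omega> \<le> b"
  shows "ennreal (hermite_fun \<rho> (\<alpha> * (x - \<theta>))) \<le> (\<integral>\<^sup>+\<omega>. ennreal (stopped_solution 1 x \<tau> \<omega>) \<partial>M)"
proof -
  let ?K = "hermite_fun \<rho> (\<alpha> * (b - \<theta>))"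
  have [measurable]: "stopped_solution 1 x \<tau> \<in> borel_measurable M"
    by (rule stopped_measurable[OF \<tau>])
  have le: "ennreal (hermite_fun \<rho> (\<alpha> * (x - \<theta>))) \<le>
    (\<integral>\<^sup>+\<omega>. ennreal (stopped_solution 1 x \<tau> \<omega>) \<partial>M) + ennreal (exp (- r * real N) * ?K)" for N
  proof -
    have "ennreal (hermite_fun \<rho> (\<alpha> * (x - \<theta>)))
      = (\<integral>\<^sup>+\<omega>. ennreal (discounted_solution 1 x (enn2real (min (\<tau> \<omega>) (ennreal (real N)))) \<omega>) \<partial>M)"
      using discounted_truncated_stopping[OF _ \<tau>, of 1 x N] by simp
    also have "\<dots> \<le> (\<integral>\<^sup>+\<omega>. ennreal (stopped_solution 1 x \<tau> \<omega>) + ennreal (exp (- r * real N) * ?K) \<partial>M)"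
    proof (rule nn_integral_mono)
      fix \<omega> assume \<omega>: "\<omega> \<in> space M"
      show "ennreal (discounted_solution 1 x (enn2real (min (\<tau> \<omega>) (ennreal (real N)))) \<omega>)
        \<le> ennreal (stopped_solution 1 x \<tau> \<omega>) + ennreal (exp (- r * real N) * ?K)"
      proof (cases "\<tau> \<omega> \<le> ennreal (real N)")
        case True
        then have "\<tau> \<omega> \<noteq> \<infinity>"
          by (auto simp: top_unique)
        with True show ?thesis
          by (simp add: stopped_solution_def min_absorb1)
      next
        case False
        then have "X x (real N) \<omega> \<le> b"
          by (intro below \<omega>) auto
        then have "discounted_solution 1 x (real N) \<omega> \<le> exp (- r * real N) * ?K"
          unfolding discounted_solution_def using alpha_pos
          by (intro mult_left_mono hermite_fun_mono rho_pos) auto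
        with False show ?thesis
          by (simp add: min_absorb2 ennreal_leI add_increasing)
      qed
    qed
    also have "\<dots> = (\<integral>\<^sup>+\<omega>. ennreal (stopped_solution 1 x \<tau> \<omega>) \<partial>M) + ennreal (exp (- r * real N) * ?K)"
      by (simp add: nn_integral_add emeasure_space_1)
    finally show ?thesis .
  qed
  have "(\<lambda>N. exp (- r * real N)) \<longlonglongrightarrow> 0"
    using r_pos by real_asymp
  then have "(\<lambda>N. (\<integral>\<^sup>+\<omega>. ennreal (stopped_solution 1 x \<tau> \<omega>) \<partial>M) + ennreal (exp (- r * real N) * ?K))
    \<longlonglongrightarrow> (\<integral>\<^sup>+\<omega>. ennreal (stopped_solution 1 x \<tau> \<omega>) \<partial>M) + ennreal 0"
    by (intro tendsto_add tendsto_const tendsto_ennrealI tendsto_mult_left_zero)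
  then show ?thesis
    using le by (intro LIMSEQ_le_const) (auto simp only: ennreal_0 add_0_right)
qed

section \<open>Upper bound and attainment\<close>

lemma reward_eq:
  "liquidation_reward r c (X x) \<tau> \<omega> = (if \<tau> \<omega> = \<infinity> then 0
    else exp (- r * enn2real (\<tau> \<omega>)) * gain (\<alpha> * (X x (enn2real (\<tau> \<omega>)) \<omega> - \<theta>)))"
  by (simp add: liquidation_reward_def gain_eq)

text \<open>The majorant is nonnegative, so it dominates the positive part of the reward as well,
  and the negative part can only lower the expectation.\<close>

lemma ereal_expectation_reward_le:
  assumes pq: "p \<ge> 0" "q \<ge> 0" and dom: "\<And>y. gain y \<le> p * f0 y + q * f0 (- y)"
    and \<tau>: "stopping_time (nat_filtration M B) \<tau>"
  shows "ereal_expectation M (liquidation_reward r c (X x) \<tau>)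
    \<le> ereal (p * f0 (\<alpha> * (x - \<theta>)) + q * f0 (- (\<alpha> * (x - \<theta>))))"
proof -
  have [measurable]: "stopped_solution e x \<tau> \<in> borel_measurable M" for e
    by (rule stopped_measurable[OF \<tau>])
  have f0_nonneg: "f0 y \<ge> 0" for y
    using f_pos(1)[of y] by simp
  have "(\<integral>\<^sup>+\<omega>. ennreal (liquidation_reward r c (X x) \<tau> \<omega>) \<partial>M)
    \<le> (\<integral>\<^sup>+\<omega>. ennreal p * ennreal (stopped_solution 1 x \<tau> \<omega>) + ennreal q * ennreal (stopped_solution (-1) x \<tau> \<omega>) \<partial>M)"
  proof (rule nn_integral_mono)
    fix \<omega>
    have "liquidation_reward r c (X x) \<tau> \<omega> \<le> p * stopped_solution 1 x \<tau> \<omega> + q * stopped_solution (-1) x \<tau> \<omega>"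
    proof (cases "\<tau> \<omega> = \<infinity>")
      case False
      let ?t = "enn2real (\<tau> \<omega>)"
      have "exp (- r * ?t) * gain (\<alpha> * (X x ?t \<omega> - \<theta>)) \<le> exp (- r * ?t) *
        (p * f0 (\<alpha> * (X x ?t \<omega> - \<theta>)) + q * f0 (- (\<alpha> * (X x ?t \<omega> - \<theta>))))"
        by (intro mult_left_mono dom) simp
      with False show ?thesis
        by (simp add: reward_eq stopped_solution_def discounted_solution_def distrib_left mult.left_commute)
    qed (simp add: reward_eq stopped_solution_def)
    then show "ennreal (liquidation_reward r c (X x) \<tau> \<omega>)
      \<le> ennreal p * ennreal (stopped_solution 1 x \<tau> \<omega>) + ennreal q * ennreal (stopped_solution (-1) x \<tau> \<omega>)"
      using pq by (simp add: stopped_solution_def discounted_nonneg ennreal_leI flip: ennreal_mult ennreal_plus)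
  qed
  also have "\<dots> = ennreal p * (\<integral>\<^sup>+\<omega>. ennreal (stopped_solution 1 x \<tau> \<omega>) \<partial>M) +
      ennreal q * (\<integral>\<^sup>+\<omega>. ennreal (stopped_solution (-1) x \<tau> \<omega>) \<partial>M)"
    by (simp add: nn_integral_add nn_integral_cmult)
  also have "\<dots> \<le> ennreal p * ennreal (f0 (1 * \<alpha> * (x - \<theta>))) + ennreal q * ennreal (f0 (-1 * \<alpha> * (x - \<theta>)))"
    by (intro add_mono mult_left_mono nn_integral_stopped_le \<tau>) auto
  also have "\<dots> = ennreal (p * f0 (\<alpha> * (x - \<theta>)) + q * f0 (- (\<alpha> * (x - \<theta>))))"
    using pq by (simp add: f0_nonneg flip: ennreal_mult ennreal_plus)
  finally have "enn2ereal (\<integral>\<^sup>+\<omega>. ennreal (liquidation_reward r c (X x) \<tau> \<omega>) \<partial>M)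
    \<le> ereal (p * f0 (\<alpha> * (x - \<theta>)) + q * f0 (- (\<alpha> * (x - \<theta>))))"
    using pq f0_nonneg by (metis add_nonneg_nonneg enn2ereal_ennreal less_eq_ennreal.rep_eq mult_nonneg_nonneg)
  then show ?thesis
    unfolding ereal_expectation_def
    by (meson ereal_diff_le_self enn2ereal_nonneg order_trans)
qed

lemma ereal_expectation_nonneg:
  assumes "\<And>\<omega>. \<omega> \<in> space M \<Longrightarrow> f \<omega> \<ge> 0" "(\<integral>\<^sup>+\<omega>. ennreal (f \<omega>) \<partial>M) = ennreal v" "v \<ge> 0"
  shows "ereal_expectation M f = ereal v"
proof -
  have "(\<integral>\<^sup>+\<omega>. ennreal (- f \<omega>) \<partial>M) = (\<integral>\<^sup>+\<omega>. 0 \<partial>M)"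
    using assms(1) by (intro nn_integral_cong) (simp add: ennreal_neg)
  then show ?thesis
    unfolding ereal_expectation_def using assms by (simp add: zero_ennreal.rep_eq)
qed

lemma liquidation_solution:
  "\<exists>b. (\<forall>b'. exp b' * F_OU \<mu> \<theta> \<sigma> r b' = (exp b' - c) * deriv (F_OU \<mu> \<theta> \<sigma> r) b' \<longleftrightarrow> b' = b) \<and>
     (\<forall>x. OU_value M B X r c x =
        ereal (if x < b then (exp b - c) / F_OU \<mu> \<theta> \<sigma> r b * F_OU \<mu> \<theta> \<sigma> r x else exp x - c)) \<and>
     (\<forall>x. let \<tau> = (\<lambda>\<omega>. Inf {ennreal t | t. t \<ge> 0 \<and> X x t \<omega> \<ge> b}) in
        stopping_time (nat_filtration M B) \<tau> \<and>
        ereal_expectation M (liquidation_reward r c (X x) \<tau>) = OU_value M B X r c x)"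
proof -
  obtain y where y: "gain_wronskian y = 0" "\<And>z. z < y \<Longrightarrow> gain_wronskian z > 0" "\<And>z z'. y \<le> z \<Longrightarrow> z < z' \<Longrightarrow> gain_wronskian z' < gain_wronskian z"
    using threshold_exists by blast
  define b where "b = \<theta> + y / \<alpha>"
  have y_eq: "\<alpha> * (b - \<theta>) = y"
    using alpha_pos by (simp add: b_def)
  have y_less: "x < b \<longleftrightarrow> \<alpha> * (x - \<theta>) < y" for x
    using alpha_pos unfolding y_eq[symmetric] by simp
  have gain_wronskian_0: "gain_wronskian z = 0 \<longleftrightarrow> z = y" for z
    using y(1) y(2)[of z] y(3)[of y z] by (cases z y rule: linorder_cases) auto
  define \<tau> where "\<tau> = (\<lambda>x \<omega>. Inf {ennreal t | t. t \<ge> 0 \<and> X x t \<omega> \<ge> b})"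
  define V where "V = (\<lambda>x. if x < b then (exp b - c) / F_OU \<mu> \<theta> \<sigma> r b * F_OU \<mu> \<theta> \<sigma> r x else exp x - c)"
  have \<tau>: "stopping_time (nat_filtration M B) (\<tau> x)" for x
    unfolding \<tau>_def by (rule hitting_time_stopping_time)
  have gain_pos: "gain z > 0" if "y \<le> z" for z
  proof -
    have "gain y * f1 y = 1 / \<alpha> * exp (\<theta> + 1 / \<alpha> * y) * f0 y"
      using y(1) by (simp add: gain_wronskian_def)
    also have "\<dots> > 0"
      using alpha_pos f_pos(1)[of y] by simp
    finally have "gain y > 0"
      using f_pos(2)[of y] by (simp add: zero_less_mult_iff)
    then show ?thesis
      using gain_mono[OF that] by simp
  qed
  have upper: "ereal_expectation M (liquidation_reward r c (X x) S) \<le> ereal (V x)"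
    if S: "stopping_time (nat_filtration M B) S" for x S
  proof -
    \<comment> \<open>One touching point covers both cases: the start if it is beyond the threshold,
      otherwise the threshold itself, where q = 0.\<close>
    define z where "z = max y (\<alpha> * (x - \<theta>))"
    obtain p q where pq: "p \<ge> 0" "q \<ge> 0" "p * f0 z + q * f0 (- z) = gain z"
      "\<And>u. gain u \<le> p * f0 u + q * f0 (- u)" "z = y \<Longrightarrow> q = 0"
      using supporting_combination[OF y, of z] by (auto simp: z_def)
    have "p * f0 (\<alpha> * (x - \<theta>)) + q * f0 (- (\<alpha> * (x - \<theta>))) = V x"
    proof (cases "x < b")
      case True
      then have "z = y"
        unfolding y_less z_def by simp
      then have "p * f0 y = gain y" "q = 0"
        using pq by auto
      then have "p = gain y / f0 y"
        using f_pos(1)[of y] by (simp add: eq_divide_eq)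
      with \<open>q = 0\<close> True show ?thesis
        unfolding V_def F_OU_eq y_eq gain_eq[of b, symmetric] by simp
    next
      case False
      then have "z = \<alpha> * (x - \<theta>)"
        unfolding y_less z_def by simp
      then show ?thesis
        using pq(3) False by (simp add: V_def gain_eq)
    qed
    then show ?thesis
      using ereal_expectation_reward_le[OF pq(1,2,4) S, of x] by simp
  qed
  have attained: "ereal_expectation M (liquidation_reward r c (X x) (\<tau> x)) = ereal (V x)" for x
  proof (cases "x < b")
    case False
    have zero: "\<tau> x \<omega> = 0" if "\<omega> \<in> space M" for \<omega>
    proof -
      have "\<tau> x \<omega> \<le> ennreal 0"
        unfolding \<tau>_def by (intro Inf_lower) (use X_0[OF that] False in force)
      then show ?thesis
        by simp
    qed
    have g: "exp x - c \<ge> 0"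
      using gain_pos[of "\<alpha> * (x - \<theta>)"] False by (simp add: y_less gain_eq)
    have reward: "liquidation_reward r c (X x) (\<tau> x) \<omega> = exp x - c" if "\<omega> \<in> space M" for \<omega>
      using X_0[OF that] zero[OF that] by (simp add: liquidation_reward_def)
    show ?thesis
    proof (rule ereal_expectation_nonneg)
      have "(\<integral>\<^sup>+\<omega>. ennreal (liquidation_reward r c (X x) (\<tau> x) \<omega>) \<partial>M) = (\<integral>\<^sup>+\<omega>. ennreal (exp x - c) \<partial>M)"
        by (intro nn_integral_cong) (simp add: reward)
      then show "(\<integral>\<^sup>+\<omega>. ennreal (liquidation_reward r c (X x) (\<tau> x) \<omega>) \<partial>M) = ennreal (V x)"
        using False by (simp add: V_def emeasure_space_1)
    qed (use g False in \<open>auto simp: reward V_def\<close>)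
  next
    case True
    define p where "p = gain y / f0 y"
    have p: "p \<ge> 0"
      using gain_pos[of y] f_pos(1)[of y] by (simp add: p_def)
    \<comment> \<open>Starting below b, a finite hitting time finds the process exactly at b, so the
      gain there is p times the solution; on an infinite one both sides are 0.\<close>
    have reward: "liquidation_reward r c (X x) (\<tau> x) \<omega> = p * stopped_solution 1 x (\<tau> x) \<omega>" if \<omega>: "\<omega> \<in> space M" for \<omega>
    proof (cases "\<tau> x \<omega> = \<infinity>")
      case False
      define t where "t = enn2real (\<tau> x \<omega>)"
      have t: "t \<ge> 0" "\<tau> x \<omega> = ennreal t"
        using False by (simp_all add: t_def less_top)
      have "X x t \<omega> = b"
        by (rule hitting_time_attained[OF X_continuous[OF \<omega>]])
           (use X_0[OF \<omega>] True t in \<open>auto simp: \<tau>_def\<close>)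
      then show ?thesis
        using False f_pos(1)[of y] unfolding reward_eq stopped_solution_def discounted_solution_def t_def[symmetric]
        by (simp add: y_eq p_def)
    qed (simp add: reward_eq stopped_solution_def)
    have V: "V x = p * f0 (\<alpha> * (x - \<theta>))"
      using True unfolding V_def F_OU_eq y_eq gain_eq[of b, symmetric] p_def by simp
    have "(\<integral>\<^sup>+\<omega>. ennreal (stopped_solution 1 x (\<tau> x) \<omega>) \<partial>M) = ennreal (f0 (\<alpha> * (x - \<theta>)))"
    proof (rule antisym)
      show "(\<integral>\<^sup>+\<omega>. ennreal (stopped_solution 1 x (\<tau> x) \<omega>) \<partial>M) \<le> ennreal (f0 (\<alpha> * (x - \<theta>)))"
        using nn_integral_stopped_le[OF _ \<tau>, of 1 x] by simp
      show "ennreal (f0 (\<alpha> * (x - \<theta>))) \<le> (\<integral>\<^sup>+\<omega>. ennreal (stopped_solution 1 x (\<tau> x) \<omega>) \<partial>M)"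
      proof (rule nn_integral_stopped_ge[OF \<tau>])
        fix \<omega> t assume \<omega>: "\<omega> \<in> space M" and t: "t \<ge> 0" "ennreal t < \<tau> x \<omega>"
        show "X x t \<omega> \<le> b"
        proof (rule ccontr)
          assume "\<not> X x t \<omega> \<le> b"
          then have "\<tau> x \<omega> \<le> ennreal t"
            unfolding \<tau>_def using t(1) by (intro Inf_lower) auto
          with t(2) show False
            by simp
        qed
      qed
    qed
    moreover have "stopped_solution 1 x (\<tau> x) \<in> borel_measurable M"
      by (rule stopped_measurable[OF \<tau>])
    ultimately have int: "(\<integral>\<^sup>+\<omega>. ennreal p * ennreal (stopped_solution 1 x (\<tau> x) \<omega>) \<partial>M) = ennreal (V x)"
      unfolding V using p by (simp add: nn_integral_cmult ennreal_mult' less_imp_le[OF f_pos(1)])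
    show ?thesis
    proof (rule ereal_expectation_nonneg)
      have "(\<integral>\<^sup>+\<omega>. ennreal (liquidation_reward r c (X x) (\<tau> x) \<omega>) \<partial>M)
        = (\<integral>\<^sup>+\<omega>. ennreal p * ennreal (stopped_solution 1 x (\<tau> x) \<omega>) \<partial>M)"
        using p by (intro nn_integral_cong) (simp add: reward ennreal_mult')
      with int show "(\<integral>\<^sup>+\<omega>. ennreal (liquidation_reward r c (X x) (\<tau> x) \<omega>) \<partial>M) = ennreal (V x)"
        by simp
      show "V x \<ge> 0"
        unfolding V using p f_pos(1) by (simp add: less_imp_le)
      show "liquidation_reward r c (X x) (\<tau> x) \<omega> \<ge> 0" if "\<omega> \<in> space M" for \<omega>
        unfolding reward[OF that] using p by (simp add: stopped_solution_def discounted_nonneg)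
    qed
  qed
  have OU_value_eq: "OU_value M B X r c x = ereal (V x)" for x
    unfolding OU_value_def
  proof (rule antisym)
    show "(SUP \<tau>\<in>{\<tau>. stopping_time (nat_filtration M B) \<tau>}.
        ereal_expectation M (liquidation_reward r c (X x) \<tau>)) \<le> ereal (V x)"
      by (intro SUP_least) (auto intro: upper)
    show "ereal (V x) \<le> (SUP \<tau>\<in>{\<tau>. stopping_time (nat_filtration M B) \<tau>}.
        ereal_expectation M (liquidation_reward r c (X x) \<tau>))"
      unfolding attained[symmetric] by (intro SUP_upper) (simp add: \<tau>)
  qed
  have "\<alpha> * (b' - \<theta>) = y \<longleftrightarrow> b' = b" for b'
    using alpha_pos by (auto simp: b_def field_simps)
  then show ?thesis
    using OU_value_eq attained \<tau> unfolding smooth_fit_iff gain_wronskian_0 \<tau>_def V_def Let_def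
    by (intro exI[of _ b]) simp
qed

end

theorem theorem3p1:
  fixes M :: "'a measure" and B :: "real \<Rightarrow> 'a \<Rightarrow> real"
    and X :: "real \<Rightarrow> real \<Rightarrow> 'a \<Rightarrow> real"
    and \<mu> \<sigma> \<theta> r c :: real
  assumes "\<mu> > 0" and "\<sigma> > 0" and "r > 0" and "c > 0"
    and "std_brownian_motion M B"
    and "is_OU_process M B \<mu> \<theta> \<sigma> X"
  defines "F \<equiv> F_OU \<mu> \<theta> \<sigma> r"
  shows "\<exists>b. (\<forall>b'. exp b' * F b' = (exp b' - c) * deriv F b' \<longleftrightarrow> b' = b) \<and>
             (\<forall>x. OU_value M B X r c x =
                    ereal (if x < b then (exp b - c) / F b * F x else exp x - c)) \<and>
             (\<forall>x. let \<tau> = (\<lambda>\<omega>. Inf {ennreal t | t. t \<ge> 0 \<and> X x t \<omega> \<ge> b}) in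
                    stopping_time (nat_filtration M B) \<tau> \<and>
                    ereal_expectation M (liquidation_reward r c (X x) \<tau>) = OU_value M B X r c x)"
proof -
  interpret ou_stopping M B \<mu> \<theta> \<sigma> X r c
    by unfold_locales (use assms in auto)
  show ?thesis
    unfolding F_def by (rule liquidation_solution)
qed

end
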